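(* Let $M=\Gamma\backslash G$ be a $2$-step nilmanifold of real dimension $6$ with first Betti number $b_1\geq 4$, and let $J$ be an invariant non-parallelizable complex structure on $M$; put $X=(M,J)$. Consider either of the following flows of invariant metrics on $X$, with initial invariant Hermitian metric $\omega_0$: (F1) $\partial_t(\Vert\Psi\Vert_{\omega_t}\omega_t^2)= i\partial\overline\partial\omega_t-\frac{\alpha'}{4}\big(\mathrm{Tr}(Rm^\tau_t\wedge Rm^\tau_t)-\mathrm{Tr}(A^\kappa_t\wedge A^\kappa_t)\big)$, $\quad H_t^{-1}\partial_t H_t=\frac{\omega_t^2\wedge A_t^\kappa}{\omega_t^3}$, where $\mathrm{Tr}(A_t^\kappa\wedge A_t^\kappa)$ is, for every $t$, a multiple of the $(2,2)$-form $\eta^{12\bar1\bar2}$; (F2) $\partial_t(\Vert\Psi\Vert_{\omega_t}\omega_t^2)= i\partial\overline\partial\omega_t-\frac{\alpha'}{4}\mathrm{Tr}(Rm^\tau_t\wedge Rm^\tau_t)$. Then, for every initial invariant Hermitian metric $\omega_0$, there exists an invariant $(1,0)$-coframe $\{\zeta^1,\zeta^2,\zeta^3\}$ on $X$ such that the family of Hermitian metrics $\omega_t$ solving (F1) or (F2) is given by $$\omega_t=\frac i2\,r(t)^2\left(\zeta^{1\bar1}+a\,\zeta^{2\bar2}+b\,\zeta^{1\bar2}+\bar b\,\zeta^{2\bar1}\right)+\frac i2\,c\,\zeta^{3\bar3}$$ for some constants $a,c\in\mathbb R$ and $b\in\mathbb C$ depending on $\omega_0$ and some function $r(t)$. Furthermore,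 if $\omega_t$ solves (F2), then $r(t)^2$ solves the ODE $$\frac{d}{dt}r(t)^2=K_1+\frac{K_2}{r(t)^4},$$ where $K_1=K_1(\omega_0)\in\mathbb R$ and $K_2=K_2(\omega_0,\alpha',\tau)\in\mathbb R$ are constants.
   Context: Notation: $\zeta^{i\bar j}=\zeta^i\wedge\overline{\zeta^j}$, $\zeta^{12\bar1\bar2}=\zeta^1\wedge\zeta^2\wedge\overline{\zeta^1}\wedge\overline{\zeta^2}$, etc. All structures (complex structure, metrics, forms) are invariant, i.e. induced by left-invariant ones on the $2$-step nilpotent Lie group $G$; $\Gamma$ is a co-compact lattice. "Non-parallelizable" means that $(G,J)$ is not a complex Lie group. Standing fact and choice of $\Psi$: under these hypotheses there is a left-invariant $(1,0)$-coframe $\{\eta^1,\eta^2,\eta^3\}$ with $d\eta^1=d\eta^2=0$, $d\eta^3=\rho\,\eta^{12}+\eta^{1\bar1}+\lambda\,\eta^{1\bar2}+(x+iy)\,\eta^{2\bar2}$, where $x,y,\lambda\in\mathbb R$, $\lambda\ge0$, $\rho\in\{0,1\}$. Fix such a coframe and let $\Psi=\eta^1\wedge\eta^2\wedge\eta^3$. For a Hermitian metric written as $\omega=\frac i2\sum_{j,l}h_{j\bar l}\,\eta^{j\bar l}$ with $(h_{j\bar l})$ positive definite Hermitian, the norm is $\Vert\Psi\Vert_\omega^2=8/\det(h_{j\bar l})$. Gauduchon connections: for a Hermitian structure $(J,\omega)$, $\nabla^\tau$ ($\tau\in\mathbb R$) is the canonical line of Hermitian connections, affine in $\tau$, with $\nabla^{1}$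 the Chern connection (torsion without $(1,1)$-part) and $\nabla^{-1}$ the Strominger–Bismut connection (totally skew-symmetric torsion), i.e. $\nabla^\tau=\frac{1+\tau}2\nabla^1+\frac{1-\tau}2\nabla^{-1}$. $Rm^\tau_t$ is the curvature of the Gauduchon connection $\nabla^\tau$ of $\omega_t$. For curvature $2$-forms $\Omega^i_j=d\sigma^i_j+\sum_k\sigma^i_k\wedge\sigma^k_j$ in a real orthonormal frame, the trace is $\mathrm{Tr}(\Omega\wedge\Omega)=\sum_{i<j}\Omega^i_j\wedge\Omega^i_j$. In (F1), $H_t$ is an (invariant) Hermitian metric along the fibres of a holomorphic vector bundle $E\to X$, and $A_t^\kappa$ is the curvature of a Gauduchon connection $\nabla^\kappa$ on $(E,H_t)$. $\alpha'\in\mathbb R$ is a constant (slope parameter). *)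

theory Defs
  imports "HOL-Analysis.Analysis" "HOL-Homology.Homology" "HOL-Library.Extended_Nat"
begin

section \<open>Two-step nilmanifolds\<close>

definition lie_bracket :: "('g::euclidean_space \<Rightarrow> 'g \<Rightarrow> 'g) \<Rightarrow> bool" where
  "lie_bracket br \<longleftrightarrow> bilinear br \<and> (\<forall>x. br x x = 0) \<and>
     (\<forall>x y z. br x (br y z) + br y (br z x) + br z (br x y) = 0)"

definition two_step_nilpotent :: "('g::euclidean_space \<Rightarrow> 'g \<Rightarrow> 'g) \<Rightarrow> bool" where
  "two_step_nilpotent br \<longleftrightarrow> lie_bracket br \<and>
     (\<exists>x y. br x y \<noteq> 0) \<and> (\<forall>x y z. br (br x y) z = 0)"

text \<open>
  The simply connected 2-step nilpotent Lie group with Lie algebra \<open>br\<close> is modelled in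
  exponential coordinates: its underlying manifold is the Lie algebra itself, with the
  Baker--Campbell--Hausdorff product, which stops after the first bracket; the inverse of
  \<open>x\<close> is \<open>- x\<close>.
\<close>

definition bch :: "('g::euclidean_space \<Rightarrow> 'g \<Rightarrow> 'g) \<Rightarrow> 'g \<Rightarrow> 'g \<Rightarrow> 'g" where
  "bch br x y = x + y + (1/2) *\<^sub>R br x y"

definition cocompact_lattice :: "('g::euclidean_space \<Rightarrow> 'g \<Rightarrow> 'g) \<Rightarrow> 'g set \<Rightarrow> bool" where
  "cocompact_lattice br \<Gamma> \<longleftrightarrow>
     0 \<in> \<Gamma> \<and> (\<forall>x\<in>\<Gamma>. \<forall>y\<in>\<Gamma>. bch br x y \<in> \<Gamma>) \<and> (\<forall>x\<in>\<Gamma>. - x \<in> \<Gamma>) \<and>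
     discrete \<Gamma> \<and>
     (\<exists>K. compact K \<and> (\<forall>x. \<exists>\<gamma>\<in>\<Gamma>. \<exists>k\<in>K. x = bch br \<gamma> k))"

definition orbit_class :: "('g::euclidean_space \<Rightarrow> 'g \<Rightarrow> 'g) \<Rightarrow> 'g set \<Rightarrow> 'g \<Rightarrow> 'g set" where
  "orbit_class br \<Gamma> x = (\<lambda>\<gamma>. bch br \<gamma> x) ` \<Gamma>"

definition nilmanifold :: "('g::euclidean_space \<Rightarrow> 'g \<Rightarrow> 'g) \<Rightarrow> 'g set \<Rightarrow> 'g set topology" where
  "nilmanifold br \<Gamma> =
     topology (\<lambda>U. U \<subseteq> range (orbit_class br \<Gamma>) \<and> open (orbit_class br \<Gamma> -` U))"

lemma openin_nilmanifold:
  "openin (nilmanifold br \<Gamma>) U \<longleftrightarrow>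
     U \<subseteq> range (orbit_class br \<Gamma>) \<and> open (orbit_class br \<Gamma> -` U)"
proof -
  have "istopology (\<lambda>U. U \<subseteq> range (orbit_class br \<Gamma>) \<and> open (orbit_class br \<Gamma> -` U))"
    unfolding istopology_def by (auto simp: vimage_Union intro: open_Int open_UN)
  then show ?thesis
    unfolding nilmanifold_def by (simp add: topology_inverse')
qed

lemma topspace_nilmanifold: "topspace (nilmanifold br \<Gamma>) = range (orbit_class br \<Gamma>)"
proof (rule antisym)
  show "topspace (nilmanifold br \<Gamma>) \<subseteq> range (orbit_class br \<Gamma>)"
    using openin_topspace[of "nilmanifold br \<Gamma>"] unfolding openin_nilmanifold by blast
  have "orbit_class br \<Gamma> -` range (orbit_class br \<Gamma>) = UNIV"
    by auto
  then have "openin (nilmanifold br \<Gamma>) (range (orbit_class br \<Gamma>))"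
    by (simp add: openin_nilmanifold)
  then show "range (orbit_class br \<Gamma>) \<subseteq> topspace (nilmanifold br \<Gamma>)"
    by (rule openin_subset)
qed

lemma quotient_map_nilmanifold:
  "quotient_map euclidean (nilmanifold br \<Gamma>) (orbit_class br \<Gamma>)"
  by (auto simp: quotient_map_def openin_nilmanifold topspace_nilmanifold vimage_def)

definition int_independent :: "('a, 'b) monoid_scheme \<Rightarrow> 'a set \<Rightarrow> bool" where
  "int_independent G S \<longleftrightarrow> finite S \<and> S \<subseteq> carrier G \<and>
     (\<forall>c::'a \<Rightarrow> int. finprod G (\<lambda>x. x [^]\<^bsub>G\<^esub> c x) S = \<one>\<^bsub>G\<^esub> \<longrightarrow> (\<forall>x\<in>S. c x = 0))"

text \<open>The Betti number is the rank of the integral singular homology group.\<close>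

definition betti :: "int \<Rightarrow> 'a topology \<Rightarrow> enat" where
  "betti p X = (SUP S \<in> {S. int_independent (homology_group p X) S}. enat (card S))"


section \<open>Invariant complex structures\<close>

definition complex_structure ::
  "('g::euclidean_space \<Rightarrow> 'g \<Rightarrow> 'g) \<Rightarrow> ('g \<Rightarrow> 'g) \<Rightarrow> bool" where
  "complex_structure br J \<longleftrightarrow> linear J \<and> (\<forall>x. J (J x) = - x) \<and>
     (\<forall>x y. br (J x) (J y) - J (br (J x) y) - J (br x (J y)) - br x y = 0)"

text \<open>\<open>(G, J)\<close> is a complex Lie group iff the bracket is complex bilinear.\<close>

definition parallelizable ::
  "('g::euclidean_space \<Rightarrow> 'g \<Rightarrow> 'g) \<Rightarrow> ('g \<Rightarrow> 'g) \<Rightarrow> bool" where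
  "parallelizable br J \<longleftrightarrow> (\<forall>x y. br (J x) y = J (br x y))"


section \<open>Invariant complex-valued forms\<close>

text \<open>
  A left-invariant form of degree \<open>p\<close> is a real-multilinear alternating function of \<open>p\<close> vectors
  of the Lie algebra, represented as a function on lists that is \<open>0\<close> on lists whose length is
  not \<open>p\<close>.
\<close>

type_synonym 'g form = "'g list \<Rightarrow> complex"

definition form1 :: "('g \<Rightarrow> complex) \<Rightarrow> 'g form" where
  "form1 f vs = (case vs of [v] \<Rightarrow> f v | _ \<Rightarrow> 0)"

definition form2 :: "('g \<Rightarrow> 'g \<Rightarrow> complex) \<Rightarrow> 'g form" where
  "form2 f vs = (case vs of [v, w] \<Rightarrow> f v w | _ \<Rightarrow> 0)"

text \<open>
  The wedge product is computed by the rule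
  \<open>\<iota>\<^sub>v (\<alpha> \<and> \<beta>) = \<iota>\<^sub>v \<alpha> \<and> \<beta> + (-1)\<^sup>p \<alpha> \<and> \<iota>\<^sub>v \<beta>\<close> for \<open>\<alpha>\<close> of degree \<open>p\<close>; the
  normalisation is the one without factorials, see \<open>wedge_form1\<close> and \<open>wedge_form2\<close>.
\<close>

fun wedge :: "'g form \<Rightarrow> 'g form \<Rightarrow> 'g form" where
  "wedge \<alpha> \<beta> [] = \<alpha> [] * \<beta> []"
| "wedge \<alpha> \<beta> (v # vs) =
     wedge (\<lambda>us. \<alpha> (v # us)) \<beta> vs +
     wedge (\<lambda>us. (-1) ^ length us * \<alpha> us) (\<lambda>us. \<beta> (v # us)) vs"

lemma wedge_form1:
  "wedge (form1 f) (form1 g) [v, w] = f v * g w - f w * g v"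
  by (simp add: form1_def)

lemma wedge_form2:
  "wedge (form2 f) (form2 g) [v1, v2, v3, v4] =
     f v1 v2 * g v3 v4 - f v1 v3 * g v2 v4 + f v1 v4 * g v2 v3 +
     f v2 v3 * g v1 v4 - f v2 v4 * g v1 v3 + f v3 v4 * g v1 v2"
  by (simp add: form2_def)

text \<open>The exterior differential on invariant forms (Chevalley--Eilenberg).\<close>

definition ext_d :: "('g \<Rightarrow> 'g \<Rightarrow> 'g) \<Rightarrow> 'g form \<Rightarrow> 'g form" where
  "ext_d br \<alpha> vs =
     (\<Sum>j<length vs. \<Sum>i<j.
        (-1) ^ (i + j) * \<alpha> (br (vs ! i) (vs ! j) # nths vs (- {i, j})))"

lemma ext_d_form1: "ext_d br (form1 f) [v, w] = - f (br v w)"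
  by (simp add: ext_d_def form1_def nths_Cons lessThan_Suc numeral_2_eq_2)

text \<open>
  \<open>bideg J p q \<alpha>\<close> is the \<open>(p,q)\<close>-component of a form of degree \<open>p + q\<close>: the sum over all ways
  of projecting \<open>p\<close> of the arguments by \<open>v \<mapsto> (v - iJv)/2\<close> to the holomorphic and \<open>q\<close> of them by
  \<open>v \<mapsto> (v + iJv)/2\<close> to the antiholomorphic part of the complexification, \<open>\<alpha>\<close> being extended
  complex multilinearly.
\<close>

fun bideg :: "('g \<Rightarrow> 'g) \<Rightarrow> nat \<Rightarrow> nat \<Rightarrow> 'g form \<Rightarrow> 'g form" where
  "bideg J p q \<alpha> [] = (if p = 0 \<and> q = 0 then \<alpha> [] else 0)"
| "bideg J p q \<alpha> (v # vs) =
     (if p = 0 then 0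
      else bideg J (p - 1) q (\<lambda>us. (\<alpha> (v # us) - \<i> * \<alpha> (J v # us)) / 2) vs) +
     (if q = 0 then 0
      else bideg J p (q - 1) (\<lambda>us. (\<alpha> (v # us) + \<i> * \<alpha> (J v # us)) / 2) vs)"

text \<open>The Dolbeault operators applied to a form of bidegree \<open>(p,q)\<close>.\<close>

definition dol_del ::
  "('g \<Rightarrow> 'g \<Rightarrow> 'g) \<Rightarrow> ('g \<Rightarrow> 'g) \<Rightarrow> nat \<Rightarrow> nat \<Rightarrow> 'g form \<Rightarrow> 'g form" where
  "dol_del br J p q \<alpha> = bideg J (p + 1) q (ext_d br \<alpha>)"

definition dol_delbar ::
  "('g \<Rightarrow> 'g \<Rightarrow> 'g) \<Rightarrow> ('g \<Rightarrow> 'g) \<Rightarrow> nat \<Rightarrow> nat \<Rightarrow> 'g form \<Rightarrow> 'g form" where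
  "dol_delbar br J p q \<alpha> = bideg J p (q + 1) (ext_d br \<alpha>)"

definition i_del_delbar ::
  "('g \<Rightarrow> 'g \<Rightarrow> 'g) \<Rightarrow> ('g \<Rightarrow> 'g) \<Rightarrow> 'g form \<Rightarrow> 'g form" where
  "i_del_delbar br J \<omega> = (\<lambda>vs. \<i> * dol_del br J 1 2 (dol_delbar br J 1 1 \<omega>) vs)"


section \<open>Coframes and Hermitian metrics\<close>

text \<open>
  A \<open>(1,0)\<close>-coframe is given by a complex linear isomorphism from \<open>(g, J)\<close> onto a standard complex
  vector space, the \<open>k\<close>-th covector being the \<open>k\<close>-th component. With \<open>J\<close> acting on vectors,
  \<open>(1,0)\<close>-covectors are those with \<open>\<eta> (J v) = i \<eta> v\<close>.
\<close>

definition coframe10 ::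
  "('g::euclidean_space \<Rightarrow> 'g) \<Rightarrow> ('g \<Rightarrow> complex ^ 'n) \<Rightarrow> bool" where
  "coframe10 J \<eta> \<longleftrightarrow> linear \<eta> \<and> bij \<eta> \<and> (\<forall>v. \<eta> (J v) = \<i> *s \<eta> v)"

definition cof :: "('g \<Rightarrow> complex ^ 'n) \<Rightarrow> 'n \<Rightarrow> 'g form" where
  "cof \<eta> k = form1 (\<lambda>v. \<eta> v $ k)"

definition cofbar :: "('g \<Rightarrow> complex ^ 'n) \<Rightarrow> 'n \<Rightarrow> 'g form" where
  "cofbar \<eta> k = form1 (\<lambda>v. cnj (\<eta> v $ k))"

definition eta_bar :: "('g \<Rightarrow> complex ^ 'n) \<Rightarrow> 'n \<Rightarrow> 'n \<Rightarrow> 'g form" where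
  "eta_bar \<eta> j l = wedge (cof \<eta> j) (cofbar \<eta> l)"

definition eta_1212 :: "('g \<Rightarrow> complex ^ 3) \<Rightarrow> 'g form" where
  "eta_1212 \<eta> = wedge (wedge (cof \<eta> 1) (cof \<eta> 2)) (wedge (cofbar \<eta> 1) (cofbar \<eta> 2))"

definition herm :: "complex ^ 'n ^ 'n \<Rightarrow> complex ^ 'n \<Rightarrow> complex ^ 'n \<Rightarrow> complex" where
  "herm H z w = (\<Sum>j\<in>UNIV. \<Sum>l\<in>UNIV. H $ j $ l * z $ j * cnj (w $ l))"

definition pos_def_herm :: "complex ^ 'n ^ 'n \<Rightarrow> bool" where
  "pos_def_herm H \<longleftrightarrow> (\<forall>j l. H $ l $ j = cnj (H $ j $ l)) \<and> (\<forall>z. z \<noteq> 0 \<longrightarrow> 0 < Re (herm H z z))"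

definition metric_form :: "('g \<Rightarrow> complex ^ 'n) \<Rightarrow> complex ^ 'n ^ 'n \<Rightarrow> 'g form" where
  "metric_form \<eta> h = (\<lambda>vs. \<i> / 2 * (\<Sum>j\<in>UNIV. \<Sum>l\<in>UNIV. h $ j $ l * eta_bar \<eta> j l vs))"

text \<open>The Riemannian metric \<open>g\<close> with \<open>\<omega> = g (J _) _\<close>.\<close>

definition metric_of :: "('g \<Rightarrow> 'g) \<Rightarrow> 'g form \<Rightarrow> 'g \<Rightarrow> 'g \<Rightarrow> real" where
  "metric_of J \<omega> v w = Re (\<omega> [v, J w])"

text \<open>The norm of \<open>\<Psi> = \<eta>\<^sup>1 \<and> \<eta>\<^sup>2 \<and> \<eta>\<^sup>3\<close> with respect to \<open>metric_form \<eta> h\<close>.\<close>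

definition norm_Psi :: "complex ^ 3 ^ 3 \<Rightarrow> real" where
  "norm_Psi h = sqrt (8 / Re (det h))"


section \<open>Invariant connections\<close>

text \<open>
  An invariant connection on a bundle trivialised by invariant sections, with fibre \<open>'v\<close>, is a
  bilinear map \<open>D\<close>, where \<open>D x s\<close> is the covariant derivative of the invariant section \<open>s\<close>
  along \<open>x\<close>. The tangent bundle is the case where the fibre is the Lie algebra itself.
\<close>

definition curv ::
  "('g \<Rightarrow> 'g \<Rightarrow> 'g) \<Rightarrow> ('g \<Rightarrow> 'v \<Rightarrow> 'v::ab_group_add) \<Rightarrow> 'g \<Rightarrow> 'g \<Rightarrow> 'v \<Rightarrow> 'v" where
  "curv br D x y s = D x (D y s) - D y (D x s) - D (br x y) s"

definition orthonormal_frame ::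
  "('v::euclidean_space \<Rightarrow> 'v \<Rightarrow> real) \<Rightarrow> (nat \<Rightarrow> 'v) \<Rightarrow> bool" where
  "orthonormal_frame g e \<longleftrightarrow>
     (\<forall>i<DIM('v). \<forall>j<DIM('v). g (e i) (e j) = (if i = j then 1 else 0))"

definition conn_form ::
  "('v \<Rightarrow> 'v \<Rightarrow> real) \<Rightarrow> ('g \<Rightarrow> 'v \<Rightarrow> 'v) \<Rightarrow> (nat \<Rightarrow> 'v) \<Rightarrow> nat \<Rightarrow> nat \<Rightarrow> 'g form" where
  "conn_form g D e i j = form1 (\<lambda>x. complex_of_real (g (e i) (D x (e j))))"

definition curv_form ::
  "('g \<Rightarrow> 'g \<Rightarrow> 'g) \<Rightarrow> ('v::euclidean_space \<Rightarrow> 'v \<Rightarrow> real) \<Rightarrow> ('g \<Rightarrow> 'v \<Rightarrow> 'v) \<Rightarrow> (nat \<Rightarrow> 'v) \<Rightarrow>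
    nat \<Rightarrow> nat \<Rightarrow> 'g form" where
  "curv_form br g D e i j = (\<lambda>vs. ext_d br (conn_form g D e i j) vs +
     (\<Sum>k<DIM('v). wedge (conn_form g D e i k) (conn_form g D e k j) vs))"

definition trace_curv ::
  "('g \<Rightarrow> 'g \<Rightarrow> 'g) \<Rightarrow> ('v::euclidean_space \<Rightarrow> 'v \<Rightarrow> real) \<Rightarrow> ('g \<Rightarrow> 'v \<Rightarrow> 'v) \<Rightarrow> (nat \<Rightarrow> 'v) \<Rightarrow>
    'g form" where
  "trace_curv br g D e = (\<lambda>vs. \<Sum>j<DIM('v). \<Sum>i<j.
     wedge (curv_form br g D e i j) (curv_form br g D e i j) vs)"

definition torsion :: "('g \<Rightarrow> 'g \<Rightarrow> 'g) \<Rightarrow> ('g \<Rightarrow> 'g \<Rightarrow> 'g::ab_group_add) \<Rightarrow> 'g \<Rightarrow> 'g \<Rightarrow> 'g" where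
  "torsion br D x y = D x y - D y x - br x y"

definition hermitian_connection ::
  "('g::euclidean_space \<Rightarrow> 'g) \<Rightarrow> ('g \<Rightarrow> 'g \<Rightarrow> real) \<Rightarrow> ('g \<Rightarrow> 'g \<Rightarrow> 'g) \<Rightarrow> bool" where
  "hermitian_connection J g D \<longleftrightarrow> bilinear D \<and>
     (\<forall>x y z. g (D x y) z + g y (D x z) = 0) \<and> (\<forall>x y. D x (J y) = J (D x y))"

text \<open>
  The \<open>(1,1)\<close>-part of the torsion is \<open>(T x y + T (J x) (J y)) / 2\<close>.
\<close>

definition chern_connection ::
  "('g::euclidean_space \<Rightarrow> 'g \<Rightarrow> 'g) \<Rightarrow> ('g \<Rightarrow> 'g) \<Rightarrow> ('g \<Rightarrow> 'g \<Rightarrow> real) \<Rightarrow> ('g \<Rightarrow> 'g \<Rightarrow> 'g) \<Rightarrow>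
    bool" where
  "chern_connection br J g D \<longleftrightarrow> hermitian_connection J g D \<and>
     (\<forall>x y. torsion br D x y + torsion br D (J x) (J y) = 0)"

definition bismut_connection ::
  "('g::euclidean_space \<Rightarrow> 'g \<Rightarrow> 'g) \<Rightarrow> ('g \<Rightarrow> 'g) \<Rightarrow> ('g \<Rightarrow> 'g \<Rightarrow> real) \<Rightarrow> ('g \<Rightarrow> 'g \<Rightarrow> 'g) \<Rightarrow>
    bool" where
  "bismut_connection br J g D \<longleftrightarrow> hermitian_connection J g D \<and>
     (\<forall>x y z. g (torsion br D x y) z = - g (torsion br D x z) y)"

definition gauduchon_connection ::
  "('g::euclidean_space \<Rightarrow> 'g \<Rightarrow> 'g) \<Rightarrow> ('g \<Rightarrow> 'g) \<Rightarrow> ('g \<Rightarrow> 'g \<Rightarrow> real) \<Rightarrow> real \<Rightarrow>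
    ('g \<Rightarrow> 'g \<Rightarrow> 'g) \<Rightarrow> bool" where
  "gauduchon_connection br J g \<tau> D \<longleftrightarrow>
     (\<exists>D1 D2. chern_connection br J g D1 \<and> bismut_connection br J g D2 \<and>
        (\<forall>x y. D x y = ((1 + \<tau>) / 2) *\<^sub>R D1 x y + ((1 - \<tau>) / 2) *\<^sub>R D2 x y))"


section \<open>Invariant holomorphic vector bundles\<close>

text \<open>
  An invariant holomorphic vector bundle, trivialised by an invariant smooth frame, is a
  Cauchy--Riemann operator \<open>dbar\<close> on the fibre \<open>complex ^ 'n\<close>, that is, a connection in the
  \<open>(0,1)\<close>-directions whose curvature has no \<open>(0,2)\<close>-part.
\<close>

definition holomorphic_bundle ::
  "('g::euclidean_space \<Rightarrow> 'g \<Rightarrow> 'g) \<Rightarrow> ('g \<Rightarrow> 'g) \<Rightarrow> ('g \<Rightarrow> complex ^ 'n \<Rightarrow> complex ^ 'n) \<Rightarrow>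
    bool" where
  "holomorphic_bundle br J dbar \<longleftrightarrow> bilinear dbar \<and>
     (\<forall>v z. dbar v (\<i> *s z) = \<i> *s dbar v z) \<and>
     (\<forall>v z. dbar (J v) z = - (\<i> *s dbar v z)) \<and>
     (\<forall>z k vs. bideg J 0 2 (form2 (\<lambda>v w. curv br dbar v w z $ k)) vs = 0)"

text \<open>The Chern connection of \<open>(E, H)\<close>: unitary, with \<open>(0,1)\<close>-part \<open>dbar\<close>.\<close>

definition bundle_chern ::
  "('g::euclidean_space \<Rightarrow> 'g) \<Rightarrow> ('g \<Rightarrow> complex ^ 'n \<Rightarrow> complex ^ 'n) \<Rightarrow> complex ^ 'n ^ 'n \<Rightarrow>
    ('g \<Rightarrow> complex ^ 'n \<Rightarrow> complex ^ 'n) \<Rightarrow> bool" where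
  "bundle_chern J dbar H D \<longleftrightarrow> bilinear D \<and>
     (\<forall>v z. D v (\<i> *s z) = \<i> *s D v z) \<and>
     (\<forall>v z w. herm H (D v z) w + herm H z (D v w) = 0) \<and>
     (\<forall>v z. (1/2) *s (D v z + \<i> *s D (J v) z) = dbar v z)"

text \<open>
  \<open>tangent_iso br J dbar \<Phi>\<close>: \<open>\<Phi>\<close> identifies the holomorphic tangent bundle with \<open>(E, dbar)\<close>.
  The right-hand side is the holomorphic part of \<open>[v\<^sup>0\<^sup>,\<^sup>1, x\<^sup>1\<^sup>,\<^sup>0]\<close>, as a real vector.
\<close>

definition tangent_iso ::
  "('g::euclidean_space \<Rightarrow> 'g \<Rightarrow> 'g) \<Rightarrow> ('g \<Rightarrow> 'g) \<Rightarrow> ('g \<Rightarrow> complex ^ 'n \<Rightarrow> complex ^ 'n) \<Rightarrow>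
    ('g \<Rightarrow> complex ^ 'n) \<Rightarrow> bool" where
  "tangent_iso br J dbar \<Phi> \<longleftrightarrow> coframe10 J \<Phi> \<and>
     (\<forall>v x. dbar v (\<Phi> x) =
        \<Phi> ((1/4) *\<^sub>R (br v x + br (J v) (J x) + J (br (J v) x) - J (br v (J x)))))"

text \<open>
  On an arbitrary holomorphic bundle only the Chern connection (\<open>\<kappa> = 1\<close>) is available, since the
  rest of the Gauduchon line is defined through the torsion; on the tangent bundle, with \<open>H\<close> an
  arbitrary Hermitian metric, every \<open>\<kappa>\<close> is allowed.
\<close>

definition bundle_gauduchon ::
  "('g::euclidean_space \<Rightarrow> 'g \<Rightarrow> 'g) \<Rightarrow> ('g \<Rightarrow> 'g) \<Rightarrow> ('g \<Rightarrow> complex ^ 'n \<Rightarrow> complex ^ 'n) \<Rightarrow>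
    ('g \<Rightarrow> complex ^ 'n) \<Rightarrow> complex ^ 'n ^ 'n \<Rightarrow> real \<Rightarrow>
    ('g \<Rightarrow> complex ^ 'n \<Rightarrow> complex ^ 'n) \<Rightarrow> bool" where
  "bundle_gauduchon br J dbar \<Phi> H \<kappa> D \<longleftrightarrow>
     (\<kappa> = 1 \<and> bundle_chern J dbar H D) \<or>
     (tangent_iso br J dbar \<Phi> \<and>
       (\<exists>D'. gauduchon_connection br J (\<lambda>x y. Re (herm H (\<Phi> x) (\<Phi> y))) \<kappa> D' \<and>
          (\<forall>v x. D v (\<Phi> x) = \<Phi> (D' v x))))"


section \<open>The flows\<close>

text \<open>
  A family of invariant Hermitian metrics is given by its matrices \<open>h\<close> in the coframe \<open>\<eta>\<close>
  defining \<open>\<Psi>\<close>. Time runs over an interval \<open>I\<close>, with one-sided derivatives at endpoints.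
\<close>

definition metric_flow ::
  "('g \<Rightarrow> complex ^ 3) \<Rightarrow> real set \<Rightarrow> (real \<Rightarrow> complex ^ 3 ^ 3) \<Rightarrow> real \<Rightarrow> 'g form \<Rightarrow> bool" where
  "metric_flow \<eta> I h t R \<longleftrightarrow>
     (\<forall>vs. ((\<lambda>s. complex_of_real (norm_Psi (h s)) *
                  wedge (metric_form \<eta> (h s)) (metric_form \<eta> (h s)) vs)
            has_vector_derivative R vs) (at t within I))"

definition flow_F2 ::
  "('g::euclidean_space \<Rightarrow> 'g \<Rightarrow> 'g) \<Rightarrow> ('g \<Rightarrow> 'g) \<Rightarrow> ('g \<Rightarrow> complex ^ 3) \<Rightarrow> real \<Rightarrow> real \<Rightarrow>
    real set \<Rightarrow> (real \<Rightarrow> complex ^ 3 ^ 3) \<Rightarrow> bool" where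
  "flow_F2 br J \<eta> \<alpha>' \<tau> I h \<longleftrightarrow>
     (\<forall>t\<in>I. let \<omega> = metric_form \<eta> (h t); g = metric_of J \<omega> in
        \<exists>D e. gauduchon_connection br J g \<tau> D \<and> orthonormal_frame g e \<and>
          metric_flow \<eta> I h t
            (\<lambda>vs. i_del_delbar br J \<omega> vs - complex_of_real (\<alpha>' / 4) * trace_curv br g D e vs))"

text \<open>
  \<open>Q\<close> is the endomorphism \<open>(\<omega>\<^sup>2 \<and> A) / \<omega>\<^sup>3\<close> of \<open>E\<close>, the quotient being that of top-degree forms.
  The equation for \<open>H\<close> reads \<open>(\<partial>\<^sub>t H)(z, w) = H (u Q z, w)\<close>, that is, the endomorphism
  \<open>H\<^sup>-\<^sup>1 \<partial>\<^sub>t H\<close> is \<open>u Q\<close>. The factor \<open>u\<close> is the normalisation of the curvature in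
  this equation: \<open>u = 1\<close> when \<open>A\<close> is the (skew-Hermitian) curvature itself, \<open>u = \<i>\<close> or
  \<open>u = - \<i>\<close> when \<open>A\<close> stands for its Hermitian-valued multiple.
\<close>

definition flow_F1 ::
  "('g::euclidean_space \<Rightarrow> 'g \<Rightarrow> 'g) \<Rightarrow> ('g \<Rightarrow> 'g) \<Rightarrow> ('g \<Rightarrow> complex ^ 3) \<Rightarrow> real \<Rightarrow> real \<Rightarrow>
    ('g \<Rightarrow> complex ^ 'n \<Rightarrow> complex ^ 'n) \<Rightarrow> ('g \<Rightarrow> complex ^ 'n) \<Rightarrow> real \<Rightarrow> complex \<Rightarrow>
    real set \<Rightarrow> (real \<Rightarrow> complex ^ 3 ^ 3) \<Rightarrow> (real \<Rightarrow> complex ^ 'n ^ 'n) \<Rightarrow> bool" where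
  "flow_F1 br J \<eta> \<alpha>' \<tau> dbar \<Phi> \<kappa> u I h H \<longleftrightarrow>
     (\<forall>t\<in>I. pos_def_herm (H t) \<and>
       (let \<omega> = metric_form \<eta> (h t); g = metric_of J \<omega>; gE = (\<lambda>z w. Re (herm (H t) z w)) in
        \<exists>D e A f Q.
          gauduchon_connection br J g \<tau> D \<and> orthonormal_frame g e \<and>
          bundle_gauduchon br J dbar \<Phi> (H t) \<kappa> A \<and> orthonormal_frame gE f \<and>
          (\<exists>m. \<forall>vs. trace_curv br gE A f vs = m * eta_1212 \<eta> vs) \<and>
          metric_flow \<eta> I h t
            (\<lambda>vs. i_del_delbar br J \<omega> vs - complex_of_real (\<alpha>' / 4) *
                    (trace_curv br g D e vs - trace_curv br gE A f vs)) \<and>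
          (\<forall>z k vs. wedge (wedge \<omega> \<omega>) (form2 (\<lambda>v w. curv br A v w z $ k)) vs =
                      Q z $ k * wedge (wedge \<omega> \<omega>) \<omega> vs) \<and>
          (\<forall>z w. ((\<lambda>s. herm (H s) z w) has_vector_derivative u * herm (H t) (Q z) w)
                   (at t within I))))"

end

theory Submission
  imports Defs
begin

text \<open>
  The common kernel \<open>V\<close> of \<open>\<eta>\<^sup>1\<close> and \<open>\<eta>\<^sup>2\<close> is a central, \<open>J\<close>-invariant plane containing the commutators.
  The right-hand side of either flow vanishes as soon as one argument lies in \<open>V\<close>: for
  the Dolbeault term because \<open>d\<close> only feeds commutators into the form, and for the trace of the
  curvature by the Jacobi identity in the endomorphism algebra together with the parity of the Gauduchon
  connection under the automorphism that is \<open>-1\<close> on the orthogonal complement \<open>W\<close> of \<open>V\<close> and \<open>1\<close> on \<open>V\<close>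
  (Gauduchon connections are unique, hence natural under automorphisms commuting with \<open>J\<close>).
  Hence the components of \<open>\<parallel>\<Psi>\<parallel> \<omega>\<^sup>2\<close> with an argument in \<open>V\<close> are constant, which keeps \<open>W\<close>
  orthogonal to \<open>V\<close>, freezes the metric on \<open>V\<close> and lets the metric on \<open>W\<close> only change by a factor \<open>r\<^sup>2\<close>.
  The remaining component of \<open>\<parallel>\<Psi>\<parallel> \<omega>\<^sup>2\<close> is a multiple of \<open>r\<^sup>2\<close>, that of the Dolbeault term is constant, and
  that of the trace scales like \<open>r\<^sup>-\<^sup>4\<close>, since the dilation by \<open>s\<close> on \<open>W\<close> and \<open>s\<^sup>2\<close> on \<open>V\<close> is an automorphism
  that carries the metric at time \<open>t\<close>, up to a constant factor, to the initial one.
\<close>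

section \<open>Gauduchon connections\<close>

definition pd_inner :: "('v::euclidean_space \<Rightarrow> 'v \<Rightarrow> real) \<Rightarrow> bool" where
  "pd_inner g \<longleftrightarrow> bilinear g \<and> (\<forall>x y. g x y = g y x) \<and> (\<forall>x. x \<noteq> 0 \<longrightarrow> 0 < g x x)"

definition hermitian_metric :: "('g::euclidean_space \<Rightarrow> 'g) \<Rightarrow> ('g \<Rightarrow> 'g \<Rightarrow> real) \<Rightarrow> bool" where
  "hermitian_metric J g \<longleftrightarrow> pd_inner g \<and> (\<forall>x y. g (J x) (J y) = g x y)"

lemma hermitian_metricD:
  assumes "hermitian_metric J g"
  shows "bilinear g" "g x y = g y x" "g (J x) (J y) = g x y" "g x x = 0 \<Longrightarrow> x = 0"
  using assms unfolding hermitian_metric_def pd_inner_def by (auto simp: less_le)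

lemma hermitian_metric_J:
  assumes g: "hermitian_metric J g" and JJ: "\<And>x. J (J x) = - x"
  shows "g (J x) y = - g x (J y)"
proof -
  have "g (J x) y = - g (J x) (J (J y))"
    using bilinear_rneg[OF hermitian_metricD(1)[OF g]] by (simp add: JJ)
  then show ?thesis using hermitian_metricD(3)[OF g] by simp
qed

text \<open>For the difference \<open>E\<close>, the torsion condition makes
  \<open>F x y = E x y + J (E (J x) y)\<close> symmetric. As \<open>F\<close> is antilinear in
  \<open>x\<close> and complex linear in \<open>y\<close>, it vanishes. So \<open>E (J x)\<close> is
  \<open>J\<close> composed with \<open>E x\<close>; the first is skew, the second is symmetric
  because \<open>E x\<close> is skew and commutes with \<open>J\<close>, and \<open>E\<close> is
  zero.\<close>

lemma chern_unique:
  assumes g: "hermitian_metric J g" and lJ: "linear J" and JJ: "\<And>x. J (J x) = - x"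
    and D: "chern_connection br J g D" and D': "chern_connection br J g D'"
  shows "D = D'"
proof (intro ext)
  fix x0 y0
  note bg = hermitian_metricD(1)[OF g]
  define E where "E x y = D x y - D' x y" for x y
  have EJ: "E x (J y) = J (E x y)" for x y
    using D D' by (simp add: E_def chern_connection_def hermitian_connection_def linear_diff[OF lJ])
  have skew: "g (E x y) z = - g y (E x z)" for x y z
  proof -
    have "g (D x y) z + g y (D x z) = 0" "g (D' x y) z + g y (D' x z) = 0"
      using D D' by (auto simp: chern_connection_def hermitian_connection_def)
    then show ?thesis
      by (simp add: E_def bilinear_lsub[OF bg] bilinear_rsub[OF bg])
  qed
  have "torsion br D x y + torsion br D (J x) (J y) = torsion br D' x y + torsion br D' (J x) (J y)" for x y
    using D D' by (simp add: chern_connection_def)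
  then have tor: "E x y + J (E (J x) y) = E y x + J (E (J y) x)" for x y
    unfolding EJ[symmetric] by (simp add: E_def torsion_def algebra_simps)
  have lin: "E (J x) y = J (E x y)" for x y
  proof -
    define F where "F x y = E x y + J (E (J x) y)" for x y
    have bD: "bilinear D" "bilinear D'"
      using D D' by (auto simp: chern_connection_def hermitian_connection_def)
    have E_neg: "E (- x) y = - E x y" for x y
      by (simp add: E_def bilinear_lneg[OF bD(1)] bilinear_lneg[OF bD(2)])
    have sym: "F x y = F y x" for x y using tor by (simp add: F_def)
    have F1: "F (J x) y = - J (F x y)" for x y
      by (simp add: F_def E_neg JJ linear_add[OF lJ] linear_neg[OF lJ])
    have F2: "F x (J y) = J (F x y)" for x y
      by (simp add: F_def EJ JJ linear_add[OF lJ] linear_neg[OF lJ])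
    have "J (F x y) = - J (F x y)"
      using F1[of x y] sym[of "J x" y] F2[of y x] sym[of x y] by simp
    then have "2 *\<^sub>R J (F x y) = 0" by (metis scaleR_2 add.left_inverse)
    then have "J (F x y) = 0" by simp
    then have "F x y = 0" using JJ[of "F x y"] linear_0[OF lJ] by simp
    then have "J (J (E (J x) y) + E x y) = 0" by (simp add: F_def linear_0[OF lJ] add.commute)
    then show ?thesis by (simp add: linear_add[OF lJ] JJ)
  qed
  have "g (J (E x0 y0)) z = 0" for z
  proof -
    have "g (J (E x0 y0)) z = - g y0 (J (E x0 z))"
      using skew[of "J x0" y0 z] by (simp add: lin)
    also have "\<dots> = g (J y0) (E x0 z)"
      using hermitian_metric_J[OF g JJ] by simp
    also have "\<dots> = - g (J (E x0 y0)) z" using skew[of x0 "J y0" z] by (simp add: EJ)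
    finally show ?thesis by simp
  qed
  then have "J (E x0 y0) = 0" using hermitian_metricD(4)[OF g] by blast
  then have "E x0 y0 = 0" using JJ[of "E x0 y0"] linear_0[OF lJ] by simp
  then show "D x0 y0 = D' x0 y0" by (simp add: E_def)
qed

text \<open>The difference tensor \<open>e\<close> is skew in all three arguments, and moving
  \<open>J\<close> from one slot to another changes the sign. Passing \<open>J\<close> once round
  the three slots shows that \<open>e x y (J z)\<close> equals its own negative.\<close>

lemma bismut_unique:
  assumes g: "hermitian_metric J g" and JJ: "\<And>x. J (J x) = - x"
    and D: "bismut_connection br J g D" and D': "bismut_connection br J g D'"
  shows "D = D'"
proof (intro ext)
  fix x0 y0
  note bg = hermitian_metricD(1)[OF g]
  define e where "e x y z = g (D x y) z - g (D' x y) z" for x y z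
  have skew23: "e x y z = - e x z y" for x y z
  proof -
    have "g (D x y) z + g y (D x z) = 0" "g (D' x y) z + g y (D' x z) = 0"
      using D D' by (auto simp: bismut_connection_def hermitian_connection_def)
    then show ?thesis
      using hermitian_metricD(2)[OF g, of y "D x z"] hermitian_metricD(2)[OF g, of y "D' x z"]
      by (simp add: e_def)
  qed
  have skew13: "e x y z = - e z y x" for x y z
  proof -
    have "g (torsion br D y x) z = - g (torsion br D y z) x"
      "g (torsion br D' y x) z = - g (torsion br D' y z) x"
      using D D' unfolding bismut_connection_def by blast+
    then have "e y x z - e x y z = - (e y z x - e z y x)"
      by (simp add: torsion_def e_def bilinear_lsub[OF bg])
    then show ?thesis using skew23[of y x z] by simp
  qed
  have skew12: "e x y z = - e y x z" for x y z
    using skew13[of x y z] skew23[of z y x] skew13[of z x y] by simp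
  have J23: "e x (J y) z = - e x y (J z)" for x y z
    using D D' hermitian_metric_J[OF g JJ]
    by (simp add: bismut_connection_def hermitian_connection_def e_def)
  have J13: "e (J x) y z = - e x y (J z)" for x y z
    using J23[of y x z] skew12[of "J x" y z] skew12[of x y "J z"] by simp
  have J12: "e (J x) y z = - e x (J y) z" for x y z
    using J13[of x z y] skew23[of "J x" y z] skew23[of x "J y" z] by simp
  have "e x y (J z) = 0" for x y z
    using J12[of x y z] J13[of x y z] J23[of x y z] by simp
  from this[of x0 y0 "J z" for z] have "g (D x0 y0 - D' x0 y0) z = 0" for z
    by (simp add: e_def JJ bilinear_rneg[OF bg] bilinear_lsub[OF bg])
  then show "D x0 y0 = D' x0 y0" using hermitian_metricD(4)[OF g] by fastforce
qed

lemma gauduchon_unique: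
  assumes g: "hermitian_metric J g" and lJ: "linear J" and JJ: "\<And>x. J (J x) = - x"
    and D: "gauduchon_connection br J g \<tau> D" and D': "gauduchon_connection br J g \<tau> D'"
  shows "D = D'"
proof -
  obtain D1 D2 where 1: "chern_connection br J g D1" "bismut_connection br J g D2"
     "\<And>x y. D x y = ((1 + \<tau>) / 2) *\<^sub>R D1 x y + ((1 - \<tau>) / 2) *\<^sub>R D2 x y"
    using D unfolding gauduchon_connection_def by blast
  obtain D3 D4 where 2: "chern_connection br J g D3" "bismut_connection br J g D4"
     "\<And>x y. D' x y = ((1 + \<tau>) / 2) *\<^sub>R D3 x y + ((1 - \<tau>) / 2) *\<^sub>R D4 x y"
    using D' unfolding gauduchon_connection_def by blast
  show ?thesis
    using chern_unique[OF g lJ JJ 1(1) 2(1)] bismut_unique[OF g JJ 1(2) 2(2)] 1(3) 2(3)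
    by (intro ext) simp
qed

lemma gauduchon_hermitian:
  assumes bg: "bilinear g" and lJ: "linear J" and D: "gauduchon_connection br J g \<tau> D"
  shows "hermitian_connection J g D"
proof -
  obtain D1 D2 where 1: "chern_connection br J g D1" "bismut_connection br J g D2"
     "\<And>x y. D x y = ((1 + \<tau>) / 2) *\<^sub>R D1 x y + ((1 - \<tau>) / 2) *\<^sub>R D2 x y"
    using D unfolding gauduchon_connection_def by blast
  have D1: "hermitian_connection J g D1" and D2: "hermitian_connection J g D2"
    using 1 by (auto simp: chern_connection_def bismut_connection_def)
  have b: "bilinear D1" "bilinear D2" using D1 D2 by (auto simp: hermitian_connection_def)
  have "bilinear D"
    using b unfolding bilinear_def 1(3) by (auto intro!: linear_compose_add linear_compose_scale_right)
  moreover have "g (D x y) z + g y (D x z) = 0" for x y z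
  proof -
    have "g (D1 x y) z + g y (D1 x z) = 0" "g (D2 x y) z + g y (D2 x z) = 0"
      using D1 D2 by (auto simp: hermitian_connection_def)
    then have "g (D1 x y) z = - g y (D1 x z)" "g (D2 x y) z = - g y (D2 x z)" by linarith+
    then show ?thesis
      by (simp add: 1(3) bilinear_ladd[OF bg] bilinear_radd[OF bg] bilinear_lmul[OF bg] bilinear_rmul[OF bg])
  qed
  moreover have "D x (J y) = J (D x y)" for x y
    using D1 D2 by (simp add: 1(3) hermitian_connection_def linear_add[OF lJ] linear_scale[OF lJ])
  ultimately show ?thesis by (simp add: hermitian_connection_def)
qed

lemma bilinear_conj:
  assumes "linear \<phi>" "linear \<psi>" "bilinear D"
  shows "bilinear (\<lambda>x y. \<psi> (D (\<phi> x) (\<phi> y)))"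
proof -
  have "linear (\<lambda>y. \<psi> (D (\<phi> x) (\<phi> y)))" "linear (\<lambda>x. \<psi> (D (\<phi> x) (\<phi> y)))" for x y
    using assms linear_compose[OF assms(1) linear_compose[of _ \<psi>]]
    by (auto simp: bilinear_def o_def)
  then show ?thesis by (simp add: bilinear_def)
qed

text \<open>All conditions on the metric are homogeneous in it, so \<open>\<phi>\<close> need only
  be a homothety. The factor \<open>l\<close> serves the dilations below, which relate the metrics
  at two times only up to a constant.\<close>

lemma gauduchon_transport:
  assumes lin: "linear \<phi>" "linear \<psi>"
    and inv: "\<And>x. \<phi> (\<psi> x) = x" "\<And>x. \<psi> (\<phi> x) = x"
    and J: "\<And>x. \<phi> (J x) = J (\<phi> x)"
    and br: "\<And>x y. \<phi> (br x y) = br (\<phi> x) (\<phi> y)"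
    and g': "\<And>x y. g' x y = l * g (\<phi> x) (\<phi> y)"
    and D: "gauduchon_connection br J g \<tau> D"
  shows "gauduchon_connection br J g' \<tau> (\<lambda>x y. \<psi> (D (\<phi> x) (\<phi> y)))"
proof -
  obtain D1 D2 where 1: "chern_connection br J g D1" "bismut_connection br J g D2"
     "\<And>x y. D x y = ((1 + \<tau>) / 2) *\<^sub>R D1 x y + ((1 - \<tau>) / 2) *\<^sub>R D2 x y"
    using D unfolding gauduchon_connection_def by blast
  have J': "\<psi> (J x) = J (\<psi> x)" for x
    using J[of "\<psi> x"] inv by metis
  have br': "br x y = \<psi> (br (\<phi> x) (\<phi> y))" for x y
    by (simp add: br[symmetric] inv)
  have h: "hermitian_connection J g' (\<lambda>x y. \<psi> (D0 (\<phi> x) (\<phi> y)))"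
    if "hermitian_connection J g D0" for D0
    using that bilinear_conj[OF lin]
    by (auto simp: hermitian_connection_def g' inv J J' distrib_left[symmetric])
  have tor: "torsion br (\<lambda>x y. \<psi> (D0 (\<phi> x) (\<phi> y))) x y = \<psi> (torsion br D0 (\<phi> x) (\<phi> y))" for D0 x y
    by (simp only: torsion_def br'[of x y] linear_diff[OF lin(2)])
  have "chern_connection br J g' (\<lambda>x y. \<psi> (D1 (\<phi> x) (\<phi> y)))"
    using 1(1) h[of D1]
    by (auto simp: chern_connection_def tor J linear_add[OF lin(2), symmetric] linear_0[OF lin(2)])
  moreover have "bismut_connection br J g' (\<lambda>x y. \<psi> (D2 (\<phi> x) (\<phi> y)))"
  proof -
    have "g' (\<psi> (torsion br D2 (\<phi> x) (\<phi> y))) z = - g' (\<psi> (torsion br D2 (\<phi> x) (\<phi> z))) y" for x y z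
    proof -
      have "g (torsion br D2 (\<phi> x) (\<phi> y)) (\<phi> z) = - g (torsion br D2 (\<phi> x) (\<phi> z)) (\<phi> y)"
        using 1(2) unfolding bismut_connection_def by blast
      then show ?thesis by (simp only: g' inv mult_minus_right)
    qed
    moreover have "hermitian_connection J g D2" using 1(2) by (simp add: bismut_connection_def)
    ultimately show ?thesis using h[of D2] unfolding bismut_connection_def tor by blast
  qed
  ultimately show ?thesis
    unfolding gauduchon_connection_def using 1(3)
    by (intro exI conjI) (auto simp: linear_add[OF lin(2)] linear_scale[OF lin(2)])
qed

section \<open>The trace of the squared curvature\<close>

definition trace_op :: "('v::euclidean_space \<Rightarrow> 'v) \<Rightarrow> real" where
  "trace_op A = (\<Sum>b\<in>Basis. A b \<bullet> b)"

lemma trace_op_comp_commute: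
  fixes A B :: "'v::euclidean_space \<Rightarrow> 'v"
  assumes "linear A" "linear B"
  shows "trace_op (\<lambda>x. A (B x)) = trace_op (\<lambda>x. B (A x))"
proof -
  have exp: "trace_op (\<lambda>x. A (B x)) = (\<Sum>b\<in>Basis. \<Sum>c\<in>Basis. (B b \<bullet> c) * (A c \<bullet> b))"
    if "linear A" for A B :: "'v \<Rightarrow> 'v"
  proof -
    have "A (B b) \<bullet> b = (\<Sum>c\<in>Basis. (B b \<bullet> c) * (A c \<bullet> b))" for b
    proof -
      have "A (B b) = A (\<Sum>c\<in>Basis. (B b \<bullet> c) *\<^sub>R c)" by (simp add: euclidean_representation)
      also have "\<dots> = (\<Sum>c\<in>Basis. (B b \<bullet> c) *\<^sub>R A c)"
        by (simp add: linear_sum[OF that] linear_scale[OF that])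
      finally show ?thesis by (simp add: inner_sum_left)
    qed
    then show ?thesis by (simp add: trace_op_def)
  qed
  show ?thesis
    unfolding exp[OF assms(1)] exp[OF assms(2)]
    by (subst sum.swap) (simp add: mult.commute)
qed

lemma trace_op_add: "trace_op (\<lambda>x. A x + B x) = trace_op A + trace_op B"
  by (simp add: trace_op_def inner_add_left sum.distrib)

lemma trace_op_diff: "trace_op (\<lambda>x. A x - B x) = trace_op A - trace_op B"
  by (simp add: trace_op_def inner_diff_left sum_subtractf)

lemma trace_op_scaleR: "trace_op (\<lambda>x. c *\<^sub>R A x) = c * trace_op A"
  by (simp add: trace_op_def sum_distrib_left)

lemma trace_op_conj:
  fixes \<phi> \<psi> A :: "'v::euclidean_space \<Rightarrow> 'v"
  assumes "linear \<phi>" "linear \<psi>" "linear A" "\<And>x. \<phi> (\<psi> x) = x"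
  shows "trace_op (\<lambda>x. \<psi> (A (\<phi> x))) = trace_op A"
  using trace_op_comp_commute[OF assms(2) linear_compose[OF assms(1,3), unfolded o_def]] assms(4) by simp

lemma bilinear_lsum: "bilinear g \<Longrightarrow> g (sum f A) y = (\<Sum>i\<in>A. g (f i) y)"
  unfolding bilinear_def using linear_sum by fast

text \<open>\<open>orthonormal_frame\<close> prescribes inner products only; that the frame spans is
  a dimension count, since orthonormality gives \<open>DIM('v)\<close> distinct independent
  vectors.\<close>

lemma orthonormal_frame_expand:
  fixes g :: "'v::euclidean_space \<Rightarrow> 'v \<Rightarrow> real"
  assumes g: "pd_inner g" and e: "orthonormal_frame g e"
  shows "v = (\<Sum>i<DIM('v). g (e i) v *\<^sub>R e i)"
proof -
  have bg: "bilinear g" using g by (simp add: pd_inner_def)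
  have ge: "g (e i) (e j) = (if i = j then 1 else 0)" if "i < DIM('v)" "j < DIM('v)" for i j
    using e that by (auto simp: orthonormal_frame_def)
  have coef: "g (\<Sum>i<DIM('v). c i *\<^sub>R e i) (e j) = c j" if j: "j < DIM('v)" for c j
  proof -
    have "g (\<Sum>i<DIM('v). c i *\<^sub>R e i) (e j) = (\<Sum>i<DIM('v). c i * g (e i) (e j))"
      by (simp add: bilinear_lsum[OF bg] bilinear_lmul[OF bg])
    also have "\<dots> = (\<Sum>i<DIM('v). if i = j then c i else 0)"
      using ge j by (intro sum.cong) auto
    finally show ?thesis using j by simp
  qed
  have inj: "inj_on e {..<DIM('v)}"
    using ge by (auto intro!: inj_onI) (metis one_neq_zero)
  have "independent (e ` {..<DIM('v)})"
  proof (rule independent_if_scalars_zero)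
    fix f x assume 0: "(\<Sum>x\<in>e ` {..<DIM('v)}. f x *\<^sub>R x) = 0" and "x \<in> e ` {..<DIM('v)}"
    then obtain j where j: "j < DIM('v)" "x = e j" by auto
    have "(\<Sum>i<DIM('v). f (e i) *\<^sub>R e i) = 0" using 0 by (simp add: sum.reindex[OF inj])
    then show "f x = 0" using coef[OF j(1), of "\<lambda>i. f (e i)"] j bilinear_lzero[OF bg] by simp
  qed simp
  then have "span (e ` {..<DIM('v)}) = UNIV"
    using card_image[OF inj] by (intro subset_antisym card_ge_dim_independent) (auto simp: dim_UNIV)
  then have "v \<in> span (e ` {..<DIM('v)})" by simp
  then obtain u where u: "v = (\<Sum>x\<in>e ` {..<DIM('v)}. u x *\<^sub>R x)"
    by (auto simp: span_finite)
  then have v: "v = (\<Sum>i<DIM('v). u (e i) *\<^sub>R e i)" by (simp add: sum.reindex[OF inj])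
  have "g (e j) v = u (e j)" if "j < DIM('v)" for j
  proof -
    have "g (e j) v = g v (e j)" using g unfolding pd_inner_def by blast
    then show ?thesis using coef[OF that, of "\<lambda>i. u (e i)"] v by simp
  qed
  then show ?thesis using v by simp
qed

text \<open>Links the frame sums of the curvature forms to a trace free of frame and metric, for
  which cyclicity and invariance under conjugation are available.\<close>

lemma trace_op_orthonormal:
  fixes g :: "'v::euclidean_space \<Rightarrow> 'v \<Rightarrow> real"
  assumes g: "pd_inner g" and e: "orthonormal_frame g e" and A: "linear A"
  shows "trace_op A = (\<Sum>i<DIM('v). g (e i) (A (e i)))"
proof -
  have bg: "bilinear g" using g by (simp add: pd_inner_def)
  have "A b \<bullet> b = (\<Sum>i<DIM('v). (A (e i) \<bullet> b) * g (e i) b)" for b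
  proof -
    have "A b = A (\<Sum>i<DIM('v). g (e i) b *\<^sub>R e i)" using orthonormal_frame_expand[OF g e, of b] by simp
    also have "\<dots> = (\<Sum>i<DIM('v). g (e i) b *\<^sub>R A (e i))"
      by (simp add: linear_sum[OF A] linear_scale[OF A])
    finally show ?thesis by (simp add: inner_sum_left mult.commute)
  qed
  then have "trace_op A = (\<Sum>i<DIM('v). \<Sum>b\<in>Basis. (A (e i) \<bullet> b) * g (e i) b)"
    unfolding trace_op_def by (simp add: sum.swap[of _ "Basis"])
  also have "\<dots> = (\<Sum>i<DIM('v). g (e i) (A (e i)))"
  proof (rule sum.cong[OF refl])
    fix i
    have l: "linear (g (e i))" using bg by (simp add: bilinear_def)
    have "g (e i) (A (e i)) = g (e i) (\<Sum>b\<in>Basis. (A (e i) \<bullet> b) *\<^sub>R b)"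
      by (simp add: euclidean_representation)
    then show "(\<Sum>b\<in>Basis. (A (e i) \<bullet> b) * g (e i) b) = g (e i) (A (e i))"
      by (simp add: linear_sum[OF l] linear_scale[OF l])
  qed
  finally show ?thesis .
qed

section \<open>The squared curvature as a four-form\<close>

definition trace4 :: "('g \<Rightarrow> 'g \<Rightarrow> 'g) \<Rightarrow> ('g \<Rightarrow> 'v \<Rightarrow> 'v::euclidean_space) \<Rightarrow> 'g \<Rightarrow> 'g \<Rightarrow> 'g \<Rightarrow> 'g \<Rightarrow> real" where
  "trace4 br D v1 v2 v3 v4 =
     trace_op (\<lambda>s. curv br D v1 v2 (curv br D v3 v4 s)) -
     trace_op (\<lambda>s. curv br D v1 v3 (curv br D v2 v4 s)) +
     trace_op (\<lambda>s. curv br D v1 v4 (curv br D v2 v3 s))"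

lemma bilinear_linear_left: "bilinear D \<Longrightarrow> linear (D x)"
  by (simp add: bilinear_def)

lemma linear_curv:
  fixes D :: "'g::euclidean_space \<Rightarrow> 'v::euclidean_space \<Rightarrow> 'v"
  assumes "bilinear D"
  shows "linear (curv br D x y)"
proof -
  note l = bilinear_linear_left[OF assms]
  have "curv br D x y = (\<lambda>s. D x (D y s) - D y (D x s) - D (br x y) s)"
    by (rule ext) (simp add: curv_def)
  then show ?thesis
    using linear_compose[OF l l, unfolded o_def]
    by (simp add: linear_compose_sub l)
qed

lemma wedge_form1_form1:
  "wedge (form1 f) (form1 h) = form2 (\<lambda>v w. f v * h w - f w * h v)"
proof
  fix vs
  have z: "wedge (\<lambda>us. 0) \<beta> ws = 0" "wedge \<alpha> (\<lambda>us. 0) ws = 0" for \<alpha> \<beta> :: "'a form" and ws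
    by (induction ws arbitrary: \<alpha> \<beta>) (auto)
  show "wedge (form1 f) (form1 h) vs = form2 (\<lambda>v w. f v * h w - f w * h v) vs"
  proof (cases vs)
    case (Cons a vs1)
    show ?thesis
    proof (cases vs1)
      case Cons1: (Cons b vs2)
      show ?thesis
        using Cons Cons1 by (cases vs2) (simp_all add: form1_def form2_def z)
    qed (simp add: Cons form1_def form2_def)
  qed (simp add: form1_def form2_def)
qed

lemma ext_d_form1_eq: "ext_d br (form1 f) = form2 (\<lambda>v w. - f (br v w))"
proof
  fix vs
  have "ext_d br (form1 f) vs = 0" if "length vs \<noteq> 2"
  proof -
    have "form1 f (br (vs ! i) (vs ! j) # nths vs (- {i, j})) = 0" if ij: "j < length vs" "i < j" for i j
    proof -
      have "{k. k < length vs \<and> k \<in> - {i, j}} = {..<length vs} - {i, j}" by auto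
      then have "length (nths vs (- {i, j})) = length vs - 2"
        using ij by (simp add: length_nths card_Diff_subset)
      then have "nths vs (- {i, j}) \<noteq> []" using that \<open>length vs \<noteq> 2\<close> ij by force
      then show ?thesis by (auto simp: form1_def neq_Nil_conv)
    qed
    then show ?thesis by (simp add: ext_d_def)
  qed
  moreover have "form2 (\<lambda>v w. - f (br v w)) vs = 0" if "length vs \<noteq> 2"
    using that by (auto simp: form2_def split: list.split)
  moreover have "ext_d br (form1 f) vs = form2 (\<lambda>v w. - f (br v w)) vs" if len: "length vs = 2"
  proof -
    obtain v w where "vs = [v, w]" using len by (auto simp: numeral_2_eq_2 length_Suc_conv)
    then show ?thesis by (simp add: ext_d_form1 form2_def)
  qed
  ultimately show "ext_d br (form1 f) vs = form2 (\<lambda>v w. - f (br v w)) vs" by metis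
qed

lemma form2_add: "form2 f vs + form2 h vs = form2 (\<lambda>v w. f v w + h v w) vs"
  by (auto simp: form2_def split: list.split)

lemma form2_sum: "(\<Sum>k\<in>K. form2 (f k) vs) = form2 (\<lambda>v w. \<Sum>k\<in>K. f k v w) vs"
  by (auto simp: form2_def split: list.split)

definition metric_connection :: "('v::euclidean_space \<Rightarrow> 'v \<Rightarrow> real) \<Rightarrow> ('g::euclidean_space \<Rightarrow> 'v \<Rightarrow> 'v) \<Rightarrow> bool" where
  "metric_connection g D \<longleftrightarrow> bilinear D \<and> (\<forall>x y z. g (D x y) z + g y (D x z) = 0)"

text \<open>Cartan's structure equation: expanding \<open>D w (e j)\<close> in the frame turns the
  sum over \<open>k\<close> into the commutator of \<open>D v\<close> and \<open>D w\<close>, and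
  the exterior differential supplies the term \<open>- D (br v w)\<close>.\<close>

lemma curv_form_eq:
  fixes g :: "'v::euclidean_space \<Rightarrow> 'v \<Rightarrow> real"
  assumes g: "pd_inner g" and e: "orthonormal_frame g e" and D: "bilinear D"
  shows "curv_form br g D e i j = form2 (\<lambda>v w. complex_of_real (g (e i) (curv br D v w (e j))))"
proof
  fix vs
  have bg: "bilinear g" using g by (simp add: pd_inner_def)
  have sumg: "g (e i) (D v (D w (e j))) = (\<Sum>k<DIM('v). g (e i) (D v (e k)) * g (e k) (D w (e j)))" for v w
  proof -
    have l: "linear (\<lambda>s. g (e i) (D v s))"
      using linear_compose[of "D v" "g (e i)"] bg D by (simp add: bilinear_def o_def)
    have "g (e i) (D v (D w (e j))) = g (e i) (D v (\<Sum>k<DIM('v). g (e k) (D w (e j)) *\<^sub>R e k))"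
      using orthonormal_frame_expand[OF g e, of "D w (e j)"] by simp
    then show ?thesis by (simp add: linear_sum[OF l] linear_scale[OF l] mult.commute)
  qed
  have "- g (e i) (D (br v w) (e j)) +
      (\<Sum>k<DIM('v). g (e i) (D v (e k)) * g (e k) (D w (e j)) - g (e i) (D w (e k)) * g (e k) (D v (e j)))
      = g (e i) (curv br D v w (e j))" for v w
    by (simp add: sum_subtractf sumg curv_def bilinear_rsub[OF bg])
  from arg_cong[OF this, of complex_of_real]
  have "- complex_of_real (g (e i) (D (br v w) (e j))) +
      (\<Sum>k<DIM('v). complex_of_real (g (e i) (D v (e k))) * of_real (g (e k) (D w (e j)))
         - of_real (g (e i) (D w (e k))) * of_real (g (e k) (D v (e j))))
      = of_real (g (e i) (curv br D v w (e j)))" for v w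
    by simp
  then show "curv_form br g D e i j vs = form2 (\<lambda>v w. complex_of_real (g (e i) (curv br D v w (e j)))) vs"
    by (simp add: curv_form_def conn_form_def ext_d_form1_eq wedge_form1_form1 form2_sum form2_add)
qed

lemma curv_skew:
  assumes g: "pd_inner g" and D: "metric_connection g D"
  shows "g s (curv br D x y s') = - g s' (curv br D x y s)"
proof -
  have bg: "bilinear g" using g by (simp add: pd_inner_def)
  have sk: "g a (D x b) = - g (D x a) b" for x a b
    using D by (simp add: metric_connection_def add_eq_0_iff)
  have "g s (curv br D x y s') = g (D y (D x s) - D x (D y s) + D (br x y) s) s'"
    by (simp add: curv_def bilinear_rsub[OF bg] bilinear_lsub[OF bg] bilinear_ladd[OF bg] sk)
  also have "\<dots> = g (- curv br D x y s) s'" by (simp add: curv_def algebra_simps)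
  also have "\<dots> = - g s' (curv br D x y s)"
    using g by (simp only: bilinear_lneg[OF bg]) (simp add: pd_inner_def)
  finally show ?thesis .
qed

lemma sum_lower_triangle_symmetric:
  fixes F :: "nat \<Rightarrow> nat \<Rightarrow> real"
  assumes "\<And>i j. F i j = F j i" "\<And>i. F i i = 0"
  shows "2 * (\<Sum>j<n. \<Sum>i<j. F i j) = (\<Sum>i<n. \<Sum>j<n. F i j)"
proof (induction n)
  case (Suc n)
  have "(\<Sum>i<Suc n. \<Sum>j<Suc n. F i j) = (\<Sum>i<n. \<Sum>j<n. F i j) + 2 * (\<Sum>i<n. F i n)"
    using assms by (simp add: sum.distrib assms(1)[of n])
  then show ?case using Suc by simp
qed simp

text \<open>\<open>trace4\<close> is half the trace of the wedge square of the curvature, whose six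
  shuffle terms coincide in pairs. The curvature matrices are skew, so a sum over
  \<open>i < j\<close> of products of entries is minus half the trace of a product: the factors 2
  cancel and a sign remains.\<close>

lemma trace_curv_eq:
  fixes g :: "'v::euclidean_space \<Rightarrow> 'v \<Rightarrow> real" and D :: "'g::euclidean_space \<Rightarrow> 'v \<Rightarrow> 'v"
  assumes g: "pd_inner g" and e: "orthonormal_frame g e" and D: "metric_connection g D"
  shows "trace_curv br g D e [v1, v2, v3, v4] = complex_of_real (- trace4 br D v1 v2 v3 v4)"
proof -
  have bD: "bilinear D" using D by (simp add: metric_connection_def)
  define \<rho> where "\<rho> v w i j = g (e i) (curv br D v w (e j))" for v w i j
  have skew: "\<rho> v w i j = - \<rho> v w j i" for v w i j
    unfolding \<rho>_def by (rule curv_skew[OF g D])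
  have tr: "trace_op (\<lambda>s. curv br D a b (curv br D c d s)) = - 2 * (\<Sum>j<DIM('v). \<Sum>i<j. \<rho> a b i j * \<rho> c d i j)"
    for a b c d
  proof -
    note l = linear_curv[OF bD]
    have "trace_op (\<lambda>s. curv br D a b (curv br D c d s)) =
        (\<Sum>i<DIM('v). g (e i) (curv br D a b (curv br D c d (e i))))"
      by (rule trace_op_orthonormal[OF g e linear_compose[OF l l, unfolded o_def]])
    also have "\<dots> = (\<Sum>i<DIM('v). \<Sum>k<DIM('v). \<rho> a b i k * \<rho> c d k i)"
    proof (rule sum.cong[OF refl])
      fix i
      have bg: "bilinear g" using g by (simp add: pd_inner_def)
      have lg: "linear (\<lambda>s. g (e i) (curv br D a b s))"
        using linear_compose[OF l[of br a b] bilinear_linear_left[OF bg]] by (simp add: o_def)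
      have "g (e i) (curv br D a b (curv br D c d (e i)))
          = g (e i) (curv br D a b (\<Sum>k<DIM('v). \<rho> c d k i *\<^sub>R e k))"
        using orthonormal_frame_expand[OF g e, of "curv br D c d (e i)"] by (simp add: \<rho>_def)
      then show "g (e i) (curv br D a b (curv br D c d (e i))) = (\<Sum>k<DIM('v). \<rho> a b i k * \<rho> c d k i)"
        by (simp add: linear_sum[OF lg] linear_scale[OF lg] \<rho>_def mult.commute)
    qed
    also have "\<dots> = - (\<Sum>i<DIM('v). \<Sum>k<DIM('v). \<rho> a b i k * \<rho> c d i k)"
      unfolding sum_negf[symmetric] using skew by (intro sum.cong refl) (metis mult_minus_right)
    also have "(\<Sum>i<DIM('v). \<Sum>k<DIM('v). \<rho> a b i k * \<rho> c d i k) =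
        2 * (\<Sum>j<DIM('v). \<Sum>i<j. \<rho> a b i j * \<rho> c d i j)"
    proof (rule sum_lower_triangle_symmetric[symmetric])
      show "\<rho> a b i j * \<rho> c d i j = \<rho> a b j i * \<rho> c d j i" for i j
        using skew[of a b i j] skew[of c d i j] by simp
      show "\<rho> a b i i * \<rho> c d i i = 0" for i
        using skew[of a b i i] by simp
    qed
    finally show ?thesis by simp
  qed
  have "trace_curv br g D e [v1, v2, v3, v4] =
    (\<Sum>j<DIM('v). \<Sum>i<j. of_real (2 * (\<rho> v1 v2 i j * \<rho> v3 v4 i j) - 2 * (\<rho> v1 v3 i j * \<rho> v2 v4 i j)
       + 2 * (\<rho> v1 v4 i j * \<rho> v2 v3 i j)))"
    unfolding trace_curv_def curv_form_eq[OF g e bD] wedge_form2 \<rho>_def[symmetric]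
    by (intro sum.cong refl) (simp add: algebra_simps)
  also have "\<dots> = of_real (- trace4 br D v1 v2 v3 v4)"
    unfolding of_real_sum[symmetric] trace4_def tr
    by (simp add: sum.distrib sum_subtractf sum_distrib_left[symmetric])
  finally show ?thesis .
qed

text \<open>As \<open>z\<close> is central, \<open>curv br D z a\<close> is the commutator of
  \<open>D z\<close> and \<open>D a\<close>. The terms quartic in \<open>D\<close> cancel by the
  Jacobi identity for endomorphisms; the cubic ones vanish by cyclicity of the trace, the parity
  \<open>\<sigma>\<close>, and the fact that \<open>p\<close> and \<open>q\<close> span
  \<open>U\<close>.\<close>

lemma trace4_vertical:
  fixes D :: "'g::euclidean_space \<Rightarrow> 'g \<Rightarrow> 'g"
  assumes D: "bilinear D"
    and br: "\<And>x y. br x y \<in> U" and central: "\<And>z x. z \<in> U \<Longrightarrow> br z x = 0"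
    and span: "\<And>z. z \<in> U \<Longrightarrow> \<exists>a b. z = a *\<^sub>R p + b *\<^sub>R q"
    and \<sigma>: "linear \<sigma>" "\<And>x. \<sigma> (\<sigma> x) = x" "\<And>z. z \<in> U \<Longrightarrow> \<sigma> z = z"
    and \<sigma>D: "\<And>x y. D (\<sigma> x) (\<sigma> y) = \<sigma> (D x y)"
    and split: "\<And>x. \<exists>h z. x = h + z \<and> \<sigma> h = - h \<and> z \<in> U"
    and z: "z \<in> U"
  shows "trace4 br D z v w u = 0"
proof -
  note lD = bilinear_linear_left[OF D]
  have lD2: "linear (\<lambda>s. D a (D b s))" for a b
    using linear_compose[OF lD lD] by (simp add: o_def)
  have lD3: "linear (\<lambda>s. D a (D b (D c s)))" for a b c
    using linear_compose[OF lD2 lD] by (simp add: o_def)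
  note Ddiff = linear_diff[OF lD]
  define P where "P a b c = trace_op (\<lambda>s. D a (D b (D c s)))" for a b c
  define Q where "Q a b c d = trace_op (\<lambda>s. D a (D b (D c (D d s))))" for a b c d
  have Pcyc: "P a b c = P b c a" for a b c
    unfolding P_def by (rule trace_op_comp_commute[OF lD lD2])
  have Qcyc: "Q a b c d = Q b c d a" for a b c d
    unfolding Q_def by (rule trace_op_comp_commute[OF lD lD3])
  have Padd: "P (a + a') b c = P a b c + P a' b c" for a a' b c
    by (simp add: P_def bilinear_ladd[OF D] trace_op_add)
  have Pscale: "P (r *\<^sub>R a) b c = r * P a b c" for r a b c
    by (simp add: P_def bilinear_lmul[OF D] trace_op_scaleR)
  have Padd2: "P a (b + b') c = P a b c + P a b' c" for a b b' c
    using Padd[of b b' c a] Pcyc[of a _ c] by simp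
  have Pscale2: "P a (r *\<^sub>R b) c = r * P a b c" for r a b c
    using Pscale[of r b c a] Pcyc[of a _ c] by simp
  have Padd3: "P a b (c + c') = P a b c + P a b c'" for a b c c'
    using Padd[of c c' a b] Pcyc[of _ a b] by simp
  have Pscale3: "P a b (r *\<^sub>R c) = r * P a b c" for r a b c
    using Pscale[of r c a b] Pcyc[of _ a b] by simp
  have P\<sigma>: "P (\<sigma> a) (\<sigma> b) (\<sigma> c) = P a b c" for a b c
  proof -
    have "D (\<sigma> a) (D (\<sigma> b) (D (\<sigma> c) s)) = \<sigma> (D a (D b (D c (\<sigma> s))))" for s
      using \<sigma>D \<sigma>(2) by metis
    then show ?thesis
      unfolding P_def using trace_op_conj[OF \<sigma>(1) \<sigma>(1) lD3 \<sigma>(2)] by simp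
  qed
  \<comment> \<open>The trace of \<open>D x [D b, D c]\<close> vanishes: by parity if \<open>x\<close> is horizontal, and because it is
    alternating in three vectors of the plane \<open>U\<close> if \<open>x\<close> is vertical.\<close>
  have key: "P x b c = P x c b" if b: "b \<in> U" and c: "c \<in> U" for x b c
  proof -
    obtain h y where x: "x = h + y" "\<sigma> h = - h" "y \<in> U" using split by blast
    have odd: "P h b c = 0" if "b \<in> U" "c \<in> U" for b c
    proof -
      have "P h b c = P ((-1) *\<^sub>R h) b c" using P\<sigma>[of h b c] x(2) \<sigma>(3) that by simp
      then show ?thesis unfolding Pscale by simp
    qed
    have "P y b c = P y c b"
    proof -
      obtain y1 y2 b1 b2 c1 c2 where *: "y = y1 *\<^sub>R p + y2 *\<^sub>R q" "b = b1 *\<^sub>R p + b2 *\<^sub>R q"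
        "c = c1 *\<^sub>R p + c2 *\<^sub>R q"
        using span x(3) b c by metis
      have "P p q p = P p p q" "P q p p = P p p q" "P q p q = P p q q" "P q q p = P p q q"
        using Pcyc by metis+
      then show ?thesis
        unfolding * Padd Padd2 Padd3 Pscale Pscale2 Pscale3 by (simp add: algebra_simps)
    qed
    then show ?thesis using odd b c by (simp add: x Padd)
  qed
  have D0: "D 0 s = 0" for s by (rule bilinear_lzero[OF D])
  \<comment> \<open>The right-hand side is the trace of \<open>D z\<close> times the double
    commutator of \<open>D a\<close> with that of \<open>D b\<close> and \<open>D c\<close>. The
    cubic part drops out by \<open>key\<close>, because both \<open>z\<close> and
    \<open>br b c\<close> lie in \<open>U\<close>.\<close>
  have tr: "trace_op (\<lambda>s. curv br D z a (curv br D b c s)) =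
      Q z a b c - Q z a c b - Q z b c a + Q z c b a" for a b c
  proof -
    have "trace_op (\<lambda>s. curv br D z a (curv br D b c s)) =
      (Q z a b c - Q z a c b - P z a (br b c)) - (Q a z b c - Q a z c b - P a z (br b c))"
      unfolding P_def Q_def
      by (simp only: curv_def central[OF z] D0 Ddiff diff_zero trace_op_diff)
    moreover have "P z a (br b c) = P a z (br b c)"
      using Pcyc[of z a "br b c"] key[OF br[of b c] z, of a] by simp
    ultimately show ?thesis using Qcyc[of a z b c] Qcyc[of a z c b] by simp
  qed
  show ?thesis unfolding trace4_def tr by simp
qed

section \<open>The Dolbeault term on vertical vectors\<close>

lemma ext_d_3: "ext_d br \<alpha> [a, b, c] = - \<alpha> [br a b, c] + \<alpha> [br a c, b] - \<alpha> [br b c, a]"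
  by (simp add: ext_d_def nths_Cons lessThan_Suc eval_nat_numeral)

lemma ext_d_4:
  "ext_d br \<alpha> [a, b, c, d] = - \<alpha> [br a b, c, d] + \<alpha> [br a c, b, d] - \<alpha> [br a d, b, c]
     - \<alpha> [br b c, a, d] + \<alpha> [br b d, a, c] - \<alpha> [br c d, a, b]"
  by (simp add: ext_d_def nths_Cons lessThan_Suc eval_nat_numeral)

text \<open>Vectors of \<open>U\<close> bracket to zero, so \<open>ext_d br \<omega>\<close>
  vanishes when its first two arguments are in \<open>U\<close>; by \<open>J\<close>-invariance of
  \<open>U\<close> so does its component \<open>\<beta>\<close>. In \<open>ext_d br \<beta>\<close>
  with \<open>z\<close> as an argument, each term either brackets \<open>z\<close>, giving zero, or
  feeds \<open>\<beta>\<close> both a commutator and \<open>z\<close>.\<close>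

lemma i_del_delbar_vertical:
  assumes br: "\<And>x y. br x y \<in> U"
    and central: "\<And>z x. z \<in> U \<Longrightarrow> br z x = 0" "\<And>z x. z \<in> U \<Longrightarrow> br x z = 0"
    and J: "\<And>z. z \<in> U \<Longrightarrow> J z \<in> U" "J 0 = 0"
    and \<omega>: "\<And>x. \<omega> [0, x] = 0" "\<And>x. \<omega> [x, 0] = 0"
    and z: "z \<in> U"
  shows "i_del_delbar br J \<omega> [z, a, b, c] = 0"
proof -
  have zero: "0 \<in> U" using br[of z z] central(1)[OF z] by simp
  define \<beta> where "\<beta> = bideg J (Suc 0) 2 (ext_d br \<omega>)"
  have 1: "ext_d br \<omega> [x, y, d] = 0" if "x \<in> U" "y \<in> U" for x y d
    using that by (simp add: ext_d_3 central \<omega>)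
  have \<beta>1: "\<beta> [x, y, d] = 0" if "x \<in> U" "y \<in> U" for x y d
    using that J by (simp add: \<beta>_def eval_nat_numeral 1)
  have 2: "ext_d br \<omega> [0, y, d] = 0" for y d
    using central[OF zero] by (simp add: ext_d_3 \<omega>)
  have \<beta>0: "\<beta> [0, y, d] = 0" for y d
    by (simp add: \<beta>_def eval_nat_numeral J(2) 2)
  have \<gamma>: "ext_d br \<beta> [x, a, b, c] = 0" if "x \<in> U" for x a b c
    using that by (simp add: ext_d_4 central \<beta>0 \<beta>1 br)
  have "bideg J 2 2 (ext_d br \<beta>) [z, a, b, c] = 0"
    using z J(1)[OF z] by (simp add: eval_nat_numeral \<gamma>)
  then show ?thesis
    by (simp add: i_del_delbar_def dol_del_def dol_delbar_def \<beta>_def numeral_2_eq_2)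
qed

section \<open>Hermitian matrices and changes of coframe\<close>

lemma metric_form_eq:
  "metric_form \<zeta> k = form2 (\<lambda>v w. \<i> / 2 * (herm k (\<zeta> v) (\<zeta> w) - herm k (\<zeta> w) (\<zeta> v)))"
proof
  fix vs
  have "(\<Sum>j\<in>UNIV. \<Sum>l\<in>UNIV. k $ j $ l * eta_bar \<zeta> j l vs) =
    form2 (\<lambda>v w. \<Sum>j\<in>UNIV. \<Sum>l\<in>UNIV. k $ j $ l * (\<zeta> v $ j * cnj (\<zeta> w $ l) - \<zeta> w $ j * cnj (\<zeta> v $ l))) vs"
    by (auto simp: eta_bar_def cof_def cofbar_def wedge_form1_form1 form2_def split: list.split)
  then show "metric_form \<zeta> k vs = form2 (\<lambda>v w. \<i> / 2 * (herm k (\<zeta> v) (\<zeta> w) - herm k (\<zeta> w) (\<zeta> v))) vs"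
    by (auto simp: metric_form_def herm_def form2_def algebra_simps sum_subtractf split: list.split)
qed

lemma pos_def_herm_cnj: "pos_def_herm k \<Longrightarrow> \<forall>j l. k $ l $ j = cnj (k $ j $ l)"
  unfolding pos_def_herm_def by blast

lemma herm_cnj:
  assumes "\<forall>j l. H $ l $ j = cnj (H $ j $ l)"
  shows "cnj (herm H z w) = herm H w z"
proof -
  have "cnj (H $ j $ l) = H $ l $ j" for j l using assms by metis
  then show ?thesis
    unfolding herm_def by (subst sum.swap) (simp add: mult_ac)
qed

lemma herm_scale: "herm H (c *s z) w = c * herm H z w" "herm H z (c *s w) = cnj c * herm H z w"
  by (simp_all add: herm_def sum_distrib_left mult_ac)

lemma herm_scaleR: "herm H (r *\<^sub>R z) w = of_real r * herm H z w" "herm H z (r *\<^sub>R w) = of_real r * herm H z w"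
  by (simp_all add: herm_def sum_distrib_left scaleR_conv_of_real[where 'a=complex] mult_ac)

lemma herm_add: "herm H (z + z') w = herm H z w + herm H z' w" "herm H z (w + w') = herm H z w + herm H z w'"
  by (simp_all add: herm_def sum.distrib algebra_simps)

lemma metric_form_pair:
  assumes "\<forall>j l. k $ l $ j = cnj (k $ j $ l)"
  shows "metric_form \<zeta> k [v, w] = complex_of_real (- Im (herm k (\<zeta> v) (\<zeta> w)))"
  using herm_cnj[OF assms, of "\<zeta> v" "\<zeta> w"]
  by (simp add: metric_form_eq form2_def complex_eq_iff flip: herm_cnj[OF assms, of "\<zeta> v" "\<zeta> w"])

lemma metric_of_metric_form:
  assumes k: "\<forall>j l. k $ l $ j = cnj (k $ j $ l)" and \<zeta>: "coframe10 J \<zeta>"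
  shows "metric_of J (metric_form \<zeta> k) v w = Re (herm k (\<zeta> v) (\<zeta> w))"
  using \<zeta> by (simp add: metric_of_def metric_form_pair[OF k] coframe10_def herm_scale)

lemma hermitian_metric_herm:
  assumes k: "pos_def_herm k" and \<zeta>: "coframe10 J \<zeta>"
  shows "hermitian_metric J (\<lambda>v w. Re (herm k (\<zeta> v) (\<zeta> w)))"
proof -
  have lin: "linear \<zeta>" and J: "\<And>v. \<zeta> (J v) = \<i> *s \<zeta> v" and inj: "inj \<zeta>"
    using \<zeta> by (auto simp: coframe10_def bij_def)
  have "bilinear (\<lambda>v w. Re (herm k (\<zeta> v) (\<zeta> w)))"
    unfolding bilinear_def
    by (intro conjI allI linearI) (simp_all add: linear_add[OF lin] linear_scale[OF lin] herm_add herm_scaleR)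
  moreover have "Re (herm k (\<zeta> v) (\<zeta> w)) = Re (herm k (\<zeta> w) (\<zeta> v))" for v w
    using herm_cnj[of k "\<zeta> v" "\<zeta> w"] k unfolding pos_def_herm_def by (metis complex_cnj(1) complex.sel(1) complex.collapse)
  moreover have "0 < Re (herm k (\<zeta> v) (\<zeta> v))" if "v \<noteq> 0" for v
    using that k linear_injective_0[OF lin] inj by (auto simp: pos_def_herm_def)
  ultimately show ?thesis
    unfolding hermitian_metric_def pd_inner_def by (simp add: J herm_scale)
qed

lemma herm_3:
  fixes k :: "complex ^ 3 ^ 3"
  shows "herm k z w =
    k $ 1 $ 1 * z $ 1 * cnj (w $ 1) + k $ 1 $ 2 * z $ 1 * cnj (w $ 2) + k $ 1 $ 3 * z $ 1 * cnj (w $ 3) +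
    k $ 2 $ 1 * z $ 2 * cnj (w $ 1) + k $ 2 $ 2 * z $ 2 * cnj (w $ 2) + k $ 2 $ 3 * z $ 2 * cnj (w $ 3) +
    k $ 3 $ 1 * z $ 3 * cnj (w $ 1) + k $ 3 $ 2 * z $ 3 * cnj (w $ 2) + k $ 3 $ 3 * z $ 3 * cnj (w $ 3)"
  by (simp add: herm_def sum_3 algebra_simps)

section \<open>Shears of the third covector\<close>

definition shear :: "complex ^ 3 \<Rightarrow> complex ^ 3 \<Rightarrow> complex ^ 3" where
  "shear s z = (\<chi> j. if j = 3 then z $ 3 + s $ 1 * z $ 1 + s $ 2 * z $ 2 else z $ j)"

text \<open>
  For \<open>s $ 3 = 0\<close>, \<open>shear_herm s h\<close> is the matrix of the metric \<open>h\<close> in the coframe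
  \<open>\<eta>\<^sup>1, \<eta>\<^sup>2, \<eta>\<^sup>3 + s\<^sub>1 \<eta>\<^sup>1 + s\<^sub>2 \<eta>\<^sup>2\<close>.
\<close>

definition shear_herm :: "complex ^ 3 \<Rightarrow> complex ^ 3 ^ 3 \<Rightarrow> complex ^ 3 ^ 3" where
  "shear_herm s h = (\<chi> j l. h $ j $ l - s $ j * h $ 3 $ l - cnj (s $ l) * h $ j $ 3 + s $ j * cnj (s $ l) * h $ 3 $ 3)"

lemma shear_nth [simp]:
  "shear s z $ 1 = z $ 1" "shear s z $ 2 = z $ 2"
  "shear s z $ 3 = z $ 3 + s $ 1 * z $ 1 + s $ 2 * z $ 2"
  by (simp_all add: shear_def)

lemma vec3_eq_iff: "(z :: 'a ^ 3) = w \<longleftrightarrow> z $ 1 = w $ 1 \<and> z $ 2 = w $ 2 \<and> z $ 3 = w $ 3"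
  by (simp add: vec_eq_iff forall_3)

lemma shear_inverse [simp]: "shear s (shear (- s) z) = z" "shear (- s) (shear s z) = z"
  by (simp_all add: vec3_eq_iff)

lemma herm_shear:
  assumes "s $ 3 = 0"
  shows "herm (shear_herm s h) (shear s z) (shear s w) = herm h z w"
  using assms by (simp add: herm_3 shear_herm_def algebra_simps)

lemma det_shear_herm: "s $ 3 = 0 \<Longrightarrow> det (shear_herm s h) = det h"
  by (simp add: det_3 shear_herm_def algebra_simps)

lemma coframe10_shear:
  assumes "coframe10 J \<eta>"
  shows "coframe10 J (\<lambda>v. shear s (\<eta> v))"
proof -
  have lin: "linear \<eta>" and J: "\<And>v. \<eta> (J v) = \<i> *s \<eta> v" and bij: "bij \<eta>"
    using assms by (auto simp: coframe10_def)
  have "linear (\<lambda>v. shear s (\<eta> v))"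
    by (rule linearI) (simp_all add: vec3_eq_iff linear_add[OF lin] linear_scale[OF lin] algebra_simps)
  moreover have "bij (shear s)"
    by (rule bij_betw_byWitness[where f' = "shear (- s)"]) auto
  then have "bij (\<lambda>v. shear s (\<eta> v))" using bij_comp[OF bij] by (simp add: o_def)
  moreover have "shear s (\<eta> (J v)) = \<i> *s shear s (\<eta> v)" for v
    by (simp add: vec3_eq_iff J algebra_simps)
  ultimately show ?thesis by (simp add: coframe10_def)
qed

lemma metric_form_shear:
  "s $ 3 = 0 \<Longrightarrow> metric_form (\<lambda>v. shear s (\<eta> v)) (shear_herm s h) = metric_form \<eta> h"
  by (simp add: metric_form_eq herm_shear)

lemma pos_def_shear_herm:
  assumes h: "pos_def_herm h" and s: "s $ 3 = 0"
  shows "pos_def_herm (shear_herm s h)"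
proof -
  have h': "cnj (h $ j $ l) = h $ l $ j" for j l using h unfolding pos_def_herm_def by metis
  have "shear_herm s h $ l $ j = cnj (shear_herm s h $ j $ l)" for j l
    by (simp add: shear_herm_def h' mult.commute)
  moreover have "0 < Re (herm (shear_herm s h) z z)" if "z \<noteq> 0" for z
  proof -
    have "shear (- s) z \<noteq> 0"
      using that shear_inverse(1)[of s z] by (auto simp: vec3_eq_iff)
    then show ?thesis
      using h herm_shear[OF s, of h "shear (- s) z" "shear (- s) z"] by (simp add: pos_def_herm_def)
  qed
  ultimately show ?thesis unfolding pos_def_herm_def by blast
qed

section \<open>Metrics in block form\<close>

definition block_herm :: "complex ^ 3 ^ 3 \<Rightarrow> bool" where
  "block_herm k \<longleftrightarrow> k $ 1 $ 3 = 0 \<and> k $ 2 $ 3 = 0 \<and> k $ 3 $ 1 = 0 \<and> k $ 3 $ 2 = 0"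

lemma pos_def_entries:
  fixes k :: "complex ^ 3 ^ 3"
  assumes k: "pos_def_herm k"
  obtains A B C :: real and b where "k $ 1 $ 1 = A" "k $ 2 $ 2 = B" "k $ 3 $ 3 = C"
    "k $ 1 $ 2 = b" "k $ 2 $ 1 = cnj b" "0 < A" "0 < C" "(cmod b)\<^sup>2 < A * B"
proof -
  have k': "k $ l $ j = cnj (k $ j $ l)" for j l using k unfolding pos_def_herm_def by blast
  have real: "k $ j $ j = of_real (Re (k $ j $ j))" for j
    using k'[of j j] by (simp add: complex_eq_iff)
  have pos: "0 < Re (herm k z z)" if "z \<noteq> 0" for z using k that by (auto simp: pos_def_herm_def)
  define A B b where "A = Re (k $ 1 $ 1)" and "B = Re (k $ 2 $ 2)" and "b = k $ 1 $ 2"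
  have ent: "k $ 1 $ 1 = A" "k $ 2 $ 2 = B" "k $ 1 $ 2 = b" "k $ 2 $ 1 = cnj b"
    using real k'[of 2 1] by (simp_all add: A_def B_def b_def)
  have "0 < A" using pos[of "vector [1, 0, 0]"] by (simp add: herm_3 ent vec3_eq_iff)
  have "0 < Re (k $ 3 $ 3)" using pos[of "vector [0, 0, 1]"] by (simp add: herm_3 vec3_eq_iff)
  \<comment> \<open>This vector is orthogonal to the first coordinate vector, so its squared length
    is \<open>A\<close> times the upper left 2 by 2 minor.\<close>
  have "0 < Re (herm k (vector [- cnj b, of_real A, 0]) (vector [- cnj b, of_real A, 0]))"
    using \<open>0 < A\<close> by (intro pos) (simp add: vec3_eq_iff)
  also have "\<dots> = A * (A * B - (cmod b)\<^sup>2)"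
    unfolding cmod_power2 by (simp add: herm_3 ent power2_eq_square algebra_simps)
  finally have "(cmod b)\<^sup>2 < A * B" using \<open>0 < A\<close> by (simp add: zero_less_mult_iff)
  then show thesis using that[OF ent(1,2) real[of 3] ent(3,4) \<open>0 < A\<close> \<open>0 < Re (k $ 3 $ 3)\<close>] by simp
qed

text \<open>Completing the square: these coefficients kill the entries (1,3) and (2,3). The kernel
  of the new third covector is then the orthogonal complement, with respect to \<open>h\<close>, of
  the common kernel of the first two.\<close>

definition block_shear :: "complex ^ 3 ^ 3 \<Rightarrow> complex ^ 3" where
  "block_shear h = vector [h $ 1 $ 3 / h $ 3 $ 3, h $ 2 $ 3 / h $ 3 $ 3, 0]"

lemma block_shear_3 [simp]: "block_shear h $ 3 = 0"
  by (simp add: block_shear_def)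

lemma block_herm_shear:
  assumes h: "pos_def_herm h"
  shows "block_herm (shear_herm (block_shear h) h)"
proof -
  obtain C :: real where C: "h $ 3 $ 3 = C" "0 < C" using pos_def_entries[OF h] by metis
  have "shear_herm (block_shear h) h $ 1 $ 3 = 0" "shear_herm (block_shear h) h $ 2 $ 3 = 0"
    using C by (simp_all add: shear_herm_def block_shear_def)
  moreover have "shear_herm (block_shear h) h $ l $ j = cnj (shear_herm (block_shear h) h $ j $ l)" for j l
    using pos_def_shear_herm[OF h block_shear_3] unfolding pos_def_herm_def by blast
  ultimately show ?thesis unfolding block_herm_def by (metis complex_cnj_zero)
qed

lemma det_block_herm:
  assumes "block_herm k" "k $ 1 $ 1 = of_real A" "k $ 2 $ 2 = of_real B" "k $ 3 $ 3 = of_real C"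
    "k $ 1 $ 2 = b" "k $ 2 $ 1 = cnj b"
  shows "Re (det k) = C * (A * B - (cmod b)\<^sup>2)"
  using assms unfolding cmod_power2
  by (simp add: det_3 block_herm_def power2_eq_square algebra_simps)

lemma norm_Psi_shear: "s $ 3 = 0 \<Longrightarrow> norm_Psi (shear_herm s h) = norm_Psi h"
  by (simp add: norm_Psi_def det_shear_herm)

lemma norm_Psi_pos:
  assumes h: "pos_def_herm h"
  shows "0 < norm_Psi h"
proof -
  define k where "k = shear_herm (block_shear h) h"
  have k: "pos_def_herm k" unfolding k_def by (rule pos_def_shear_herm[OF h]) simp
  obtain A B C b where e: "k $ 1 $ 1 = of_real A" "k $ 2 $ 2 = of_real B" "k $ 3 $ 3 = of_real C"
    "k $ 1 $ 2 = b" "k $ 2 $ 1 = cnj b" "0 < A" "0 < C" "(cmod b)\<^sup>2 < A * B"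
    using pos_def_entries[OF k] by metis
  have "0 < Re (det k)"
    using det_block_herm[OF _ e(1-5)] block_herm_shear[OF h] e(6-8) by (simp add: k_def)
  then show ?thesis by (simp add: norm_Psi_def k_def det_shear_herm)
qed

text \<open>The real values of \<open>\<parallel>\<Psi>\<parallel> \<omega>\<^sup>2\<close>, in coordinates: \<open>\<omega> (v, w) = - Im (herm k v w)\<close>.\<close>

definition omega_sq :: "complex ^ 3 ^ 3 \<Rightarrow> complex ^ 3 \<Rightarrow> complex ^ 3 \<Rightarrow> complex ^ 3 \<Rightarrow> complex ^ 3 \<Rightarrow> real" where
  "omega_sq k a b c d = 2 * norm_Psi k *
     (Im (herm k a b) * Im (herm k c d) - Im (herm k a c) * Im (herm k b d) + Im (herm k a d) * Im (herm k b c))"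

lemma omega_sq_metric_form:
  assumes k: "\<forall>j l. k $ l $ j = cnj (k $ j $ l)"
  shows "complex_of_real (norm_Psi k) * wedge (metric_form \<zeta> k) (metric_form \<zeta> k) [v1, v2, v3, v4] =
    complex_of_real (omega_sq k (\<zeta> v1) (\<zeta> v2) (\<zeta> v3) (\<zeta> v4))"
proof -
  define f where "f v w = \<i> / 2 * (herm k (\<zeta> v) (\<zeta> w) - herm k (\<zeta> w) (\<zeta> v))" for v w
  have m: "metric_form \<zeta> k = form2 f" by (simp add: metric_form_eq f_def[abs_def])
  have f: "f v w = complex_of_real (- Im (herm k (\<zeta> v) (\<zeta> w)))" for v w
    using metric_form_pair[OF k, of \<zeta> v w] by (simp add: m form2_def)
  show ?thesis unfolding m wedge_form2 f by (simp add: omega_sq_def algebra_simps)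
qed

lemma norm_Psi_block:
  assumes "block_herm k" "k $ 1 $ 1 = of_real A" "k $ 2 $ 2 = of_real B" "k $ 3 $ 3 = of_real C"
    "k $ 1 $ 2 = b" "k $ 2 $ 1 = cnj b"
  shows "norm_Psi k = sqrt (8 / (C * (A * B - (cmod b)\<^sup>2)))"
  by (simp add: norm_Psi_def det_block_herm[OF assms])

section \<open>What the components of \<open>omega_sq\<close> determine\<close>

abbreviation "e1 \<equiv> vector [1, 0, 0] :: complex ^ 3"
abbreviation "e2 \<equiv> vector [0, 1, 0] :: complex ^ 3"
abbreviation "e3 \<equiv> vector [0, 0, 1] :: complex ^ 3"

text \<open>On \<open>e3\<close> and three horizontal vectors the block form of \<open>k0\<close>
  gives zero. For \<open>k\<close> this says that the contraction of the metric form with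
  \<open>e3\<close>, restricted to the horizontal space, has zero wedge product with the metric form
  there. That space has real dimension four, where wedging one-forms with a nondegenerate two-form
  is injective.\<close>

lemma omega_sq_vertical_imp_block:
  assumes k0: "pos_def_herm k0" "block_herm k0" and k: "pos_def_herm k"
    and eq: "\<And>a b c. omega_sq k e3 a b c = omega_sq k0 e3 a b c"
  shows "block_herm k"
proof -
  obtain A B C b where e: "k $ 1 $ 1 = complex_of_real A" "k $ 2 $ 2 = complex_of_real B" "k $ 3 $ 3 = complex_of_real C"
    "k $ 1 $ 2 = b" "k $ 2 $ 1 = cnj b" "0 < A" "0 < C" "(cmod b)\<^sup>2 < A * B"
    using pos_def_entries[OF k] by metis
  define p q where "p = k $ 1 $ 3" and "q = k $ 2 $ 3"
  have pq: "k $ 1 $ 3 = p" "k $ 2 $ 3 = q" "k $ 3 $ 1 = cnj p" "k $ 3 $ 2 = cnj q"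
    using k unfolding pos_def_herm_def p_def q_def by blast+
  have n: "norm_Psi k \<noteq> 0" using norm_Psi_pos[OF k] by simp
  have zero: "Im (herm k e3 a) * Im (herm k b c) - Im (herm k e3 b) * Im (herm k a c)
      + Im (herm k e3 c) * Im (herm k a b) = 0" if "a $ 3 = 0" "b $ 3 = 0" "c $ 3 = 0" for a b c
  proof -
    have "omega_sq k e3 a b c = 0"
      unfolding eq using k0(2) that by (simp add: omega_sq_def herm_3 block_herm_def)
    then show ?thesis using n by (simp add: omega_sq_def)
  qed
  \<comment> \<open>The four real equations amount to \<open>A * q = cnj b * p\<close> and
    \<open>B * p = b * q\<close>, a system whose determinant is the positive minor.\<close>
  have 1: "Im q * A = Im p * Re b - Re p * Im b"
    using zero[of e1 "\<i> *s e1" e2] by (simp add: herm_3 e pq algebra_simps)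
  have 2: "Re q * A = Im p * Im b + Re p * Re b"
    using zero[of e1 "\<i> *s e1" "\<i> *s e2"] by (simp add: herm_3 e pq algebra_simps)
  have 3: "Im p * B = Im q * Re b + Re q * Im b"
    using zero[of e1 e2 "\<i> *s e2"] by (simp add: herm_3 e pq algebra_simps)
  have 4: "Re p * B = Re q * Re b - Im q * Im b"
    using zero[of "\<i> *s e1" e2 "\<i> *s e2"] by (simp add: herm_3 e pq algebra_simps)
  have b2: "(cmod b)\<^sup>2 = Re b * Re b + Im b * Im b" unfolding cmod_power2 by (simp add: power2_eq_square)
  have "Im p * (A * B - (cmod b)\<^sup>2) = 0"
  proof -
    have "Im p * (A * B) = (Im q * A) * Re b + (Re q * A) * Im b"
      using arg_cong[OF 3, of "(*) A"] by (simp add: algebra_simps)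
    then show ?thesis unfolding 1 2 b2 by (simp add: algebra_simps)
  qed
  then have p1: "Im p = 0" using e(8) by simp
  have "Re p * (A * B - (cmod b)\<^sup>2) = 0"
  proof -
    have "Re p * (A * B) = (Re q * A) * Re b - (Im q * A) * Im b"
      using arg_cong[OF 4, of "(*) A"] by (simp add: algebra_simps)
    then show ?thesis unfolding 1 2 b2 by (simp add: algebra_simps)
  qed
  then have p2: "Re p = 0" using e(8) by simp
  have "p = 0" "q = 0" using p1 p2 1 2 e(6) by (simp_all add: complex_eq_iff)
  then show ?thesis by (simp add: block_herm_def pq)
qed

text \<open>The components containing both \<open>e3\<close> and \<open>\<i> *s e3\<close> read off
  \<open>norm_Psi k * C\<close> times the horizontal block, so the two blocks are proportional.
  Since \<open>norm_Psi\<close> scales like the inverse of \<open>\<mu>\<close> times the square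
  root of \<open>C\<close>, comparing the factors leaves \<open>C = C0\<close>.\<close>

lemma omega_sq_vertical_eq:
  assumes k0: "pos_def_herm k0" "block_herm k0" and k: "pos_def_herm k" "block_herm k"
    and eq: "\<And>a b c. omega_sq k e3 a b c = omega_sq k0 e3 a b c"
    and \<mu>: "\<mu> = Re (k $ 1 $ 1) / Re (k0 $ 1 $ 1)"
  shows "0 < \<mu>" "k $ 3 $ 3 = k0 $ 3 $ 3"
    "k $ 1 $ 1 = of_real \<mu> * k0 $ 1 $ 1" "k $ 2 $ 2 = of_real \<mu> * k0 $ 2 $ 2"
    "k $ 1 $ 2 = of_real \<mu> * k0 $ 1 $ 2" "k $ 2 $ 1 = of_real \<mu> * k0 $ 2 $ 1"
proof -
  obtain A B C b where e: "k $ 1 $ 1 = complex_of_real A" "k $ 2 $ 2 = complex_of_real B" "k $ 3 $ 3 = complex_of_real C"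
    "k $ 1 $ 2 = b" "k $ 2 $ 1 = cnj b" "0 < A" "0 < C" "(cmod b)\<^sup>2 < A * B"
    using pos_def_entries[OF k(1)] by metis
  obtain A0 B0 C0 b0 where e0: "k0 $ 1 $ 1 = complex_of_real A0" "k0 $ 2 $ 2 = complex_of_real B0" "k0 $ 3 $ 3 = complex_of_real C0"
    "k0 $ 1 $ 2 = b0" "k0 $ 2 $ 1 = cnj b0" "0 < A0" "0 < C0" "(cmod b0)\<^sup>2 < A0 * B0"
    using pos_def_entries[OF k0(1)] by metis
  note z = k(2)[unfolded block_herm_def] k0(2)[unfolded block_herm_def]
  define n n0 where "n = norm_Psi k * C" and "n0 = norm_Psi k0 * C0"
  have n: "0 < n" "0 < n0" using norm_Psi_pos[OF k(1)] norm_Psi_pos[OF k0(1)] e(7) e0(7) by (simp_all add: n_def n0_def)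
  have m1: "n * A = n0 * A0"
    using eq[of "\<i> *s e3" e1 "\<i> *s e1"] by (simp add: omega_sq_def herm_3 e e0 z n_def n0_def algebra_simps)
  have m2: "n * B = n0 * B0"
    using eq[of "\<i> *s e3" e2 "\<i> *s e2"] by (simp add: omega_sq_def herm_3 e e0 z n_def n0_def algebra_simps)
  have m3: "n * Im b = n0 * Im b0"
    using eq[of "\<i> *s e3" e1 e2] by (simp add: omega_sq_def herm_3 e e0 z n_def n0_def algebra_simps)
  have m4: "n * Re b = n0 * Re b0"
    using eq[of "\<i> *s e3" e1 "\<i> *s e2"] by (simp add: omega_sq_def herm_3 e e0 z n_def n0_def algebra_simps)
  have \<mu>': "\<mu> = A / A0" by (simp add: \<mu> e e0)
  have \<mu>n: "\<mu> = n0 / n" using m1 n e0(6) by (simp add: \<mu>' field_simps)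
  show "0 < \<mu>" using n by (simp add: \<mu>n)
  have A: "A = \<mu> * A0" and B: "B = \<mu> * B0" and b: "b = of_real \<mu> * b0"
    using m1 m2 m3 m4 n by (simp_all add: \<mu>n field_simps complex_eq_iff)
  then show "k $ 1 $ 1 = of_real \<mu> * k0 $ 1 $ 1" "k $ 2 $ 2 = of_real \<mu> * k0 $ 2 $ 2"
    "k $ 1 $ 2 = of_real \<mu> * k0 $ 1 $ 2" "k $ 2 $ 1 = of_real \<mu> * k0 $ 2 $ 1"
    by (simp_all add: e e0)
  define \<Delta> where "\<Delta> = A0 * B0 - (cmod b0)\<^sup>2"
  have \<Delta>: "0 < \<Delta>" using e0(8) by (simp add: \<Delta>_def)
  have "A * B - (cmod b)\<^sup>2 = \<mu>\<^sup>2 * \<Delta>"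
    by (simp add: A B b \<Delta>_def norm_mult power2_eq_square algebra_simps)
  then have "n = sqrt (8 / (C * (\<mu>\<^sup>2 * \<Delta>))) * C"
    using norm_Psi_block[OF k(2) e(1-5)] by (simp add: n_def)
  then have "(\<mu> * n)\<^sup>2 = 8 * C / \<Delta>"
    using \<Delta> e(7) \<open>0 < \<mu>\<close> by (simp add: power_mult_distrib power2_eq_square field_simps)
  moreover have "n0 = sqrt (8 / (C0 * \<Delta>)) * C0"
    using norm_Psi_block[OF k0(2) e0(1-5)] by (simp add: n0_def \<Delta>_def)
  then have "n0\<^sup>2 = 8 * C0 / \<Delta>"
    using \<Delta> e0(7) by (simp add: power_mult_distrib power2_eq_square field_simps)
  moreover have "\<mu> * n = n0" using n by (simp add: \<mu>n)
  ultimately have "C = C0" using \<Delta> by simp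
  then show "k $ 3 $ 3 = k0 $ 3 $ 3" by (simp add: e e0)
qed

text \<open>The square of the form contributes \<open>R\<close> squared and \<open>norm_Psi\<close>
  the inverse of \<open>R\<close>. The result is linear in \<open>R\<close>, which is why the flow
  becomes an ODE for the square of \<open>r\<close>.\<close>

lemma omega_sq_horizontal:
  assumes k: "block_herm k" and e: "k $ 1 $ 1 = of_real R" "k $ 2 $ 2 = of_real (R * a)" "k $ 3 $ 3 = of_real C"
    "k $ 1 $ 2 = of_real R * b" "k $ 2 $ 1 = of_real R * cnj b"
    and pos: "0 < R" "0 < C" "(cmod b)\<^sup>2 < a"
  shows "omega_sq k e1 (\<i> *s e1) e2 (\<i> *s e2) = 2 * sqrt (8 * (a - (cmod b)\<^sup>2) / C) * R"
proof -
  define \<Delta> where "\<Delta> = a - (cmod b)\<^sup>2"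
  have \<Delta>: "0 < \<Delta>" using pos by (simp add: \<Delta>_def)
  have "norm_Psi k = sqrt (8 / (C * (R * (R * a) - (cmod (of_real R * b))\<^sup>2)))"
    by (rule norm_Psi_block[OF k e(1-4)]) (simp add: e)
  also have "R * (R * a) - (cmod (of_real R * b))\<^sup>2 = R\<^sup>2 * \<Delta>"
    by (simp add: \<Delta>_def norm_mult power2_eq_square algebra_simps)
  finally have n: "norm_Psi k = sqrt (8 / (C * (R\<^sup>2 * \<Delta>)))" .
  have "norm_Psi k * (R * \<Delta>) = sqrt (8 * \<Delta> / C)"
  proof (rule power2_eq_imp_eq)
    show "(norm_Psi k * (R * \<Delta>))\<^sup>2 = (sqrt (8 * \<Delta> / C))\<^sup>2"
      using pos \<Delta> by (simp add: n power_mult_distrib power2_eq_square field_simps)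
  qed (use pos \<Delta> in \<open>simp_all add: n\<close>)
  moreover have "omega_sq k e1 (\<i> *s e1) e2 (\<i> *s e2) = 2 * norm_Psi k * (R * \<Delta>) * R"
    unfolding \<Delta>_def cmod_power2
    using k by (simp add: omega_sq_def herm_3 e block_herm_def power2_eq_square algebra_simps)
  ultimately show ?thesis by (simp add: \<Delta>_def mult.assoc)
qed

section \<open>Dilations\<close>

text \<open>What the argument takes from the structure equations: commutators lie in the common
  kernel of the first two covectors, and this kernel is central. Both properties survive a shear, so
  the given and the sheared coframes are both instances.\<close>

locale central_coframe =
  fixes br :: "'g::euclidean_space \<Rightarrow> 'g \<Rightarrow> 'g" and J :: "'g \<Rightarrow> 'g" and \<zeta> :: "'g \<Rightarrow> complex ^ 3"
  assumes br: "bilinear br" and linear_J: "linear J" and J_J: "\<And>x. J (J x) = - x"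
    and coframe: "coframe10 J \<zeta>"
    and br_vertical: "\<And>x y. \<zeta> (br x y) $ 1 = 0" "\<And>x y. \<zeta> (br x y) $ 2 = 0"
    and central: "\<And>z x. \<zeta> z $ 1 = 0 \<Longrightarrow> \<zeta> z $ 2 = 0 \<Longrightarrow> br z x = 0"
      "\<And>z x. \<zeta> z $ 1 = 0 \<Longrightarrow> \<zeta> z $ 2 = 0 \<Longrightarrow> br x z = 0"
begin

definition "vertical = {z. \<zeta> z $ 1 = 0 \<and> \<zeta> z $ 2 = 0}"

definition "dual = inv_into UNIV \<zeta>"

definition "vpart x = dual (vector [0, 0, \<zeta> x $ 3])"

text \<open>In the coframe, \<open>dil s\<close> is \<open>diag (s, s, s\<^sup>2)\<close>; this is an automorphism of the bracket.\<close>

definition "dil s x = s *\<^sub>R x + (s\<^sup>2 - s) *\<^sub>R vpart x"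

lemma linear_zeta: "linear \<zeta>" and zeta_J: "\<zeta> (J v) = \<i> *s \<zeta> v" and inj_zeta: "inj \<zeta>"
  and zeta_dual [simp]: "\<zeta> (dual c) = c"
  using coframe by (auto simp: coframe10_def bij_def dual_def surj_f_inv_f)

lemma zeta_eqI: "\<zeta> x $ 1 = \<zeta> y $ 1 \<Longrightarrow> \<zeta> x $ 2 = \<zeta> y $ 2 \<Longrightarrow> \<zeta> x $ 3 = \<zeta> y $ 3 \<Longrightarrow> x = y"
  using inj_zeta by (metis injD vec3_eq_iff)

lemmas zeta_simps = linear_add[OF linear_zeta] linear_diff[OF linear_zeta] linear_scale[OF linear_zeta]
  linear_neg[OF linear_zeta] linear_0[OF linear_zeta] zeta_J

lemma zeta_vpart [simp]: "\<zeta> (vpart x) $ 1 = 0" "\<zeta> (vpart x) $ 2 = 0" "\<zeta> (vpart x) $ 3 = \<zeta> x $ 3"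
  by (simp_all add: vpart_def)

lemma zeta_dil [simp]: "\<zeta> (dil s x) $ 1 = of_real s * \<zeta> x $ 1" "\<zeta> (dil s x) $ 2 = of_real s * \<zeta> x $ 2"
  "\<zeta> (dil s x) $ 3 = of_real (s\<^sup>2) * \<zeta> x $ 3"
  by (simp_all add: dil_def zeta_simps scaleR_conv_of_real[where 'a=complex] algebra_simps)

lemma linear_dil: "linear (dil s)"
  by (rule linearI; rule zeta_eqI) (simp_all add: zeta_simps scaleR_conv_of_real[where 'a=complex] algebra_simps)

lemma dil_dil: "s * s' = 1 \<Longrightarrow> dil s (dil s' x) = x"
proof (rule zeta_eqI)
  assume s: "s * s' = 1"
  have "complex_of_real s * complex_of_real s' = 1" using s by (metis of_real_1 of_real_mult)
  then have "complex_of_real s * (complex_of_real s' * a) = a"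
    "(complex_of_real s)\<^sup>2 * ((complex_of_real s')\<^sup>2 * a) = a" for a
    by (simp_all flip: mult.assoc power_mult_distrib)
  then show "\<zeta> (dil s (dil s' x)) $ 1 = \<zeta> x $ 1" "\<zeta> (dil s (dil s' x)) $ 2 = \<zeta> x $ 2"
    "\<zeta> (dil s (dil s' x)) $ 3 = \<zeta> x $ 3" by simp_all
qed

lemma dil_J: "dil s (J x) = J (dil s x)"
  by (rule zeta_eqI) (simp_all add: zeta_simps)

text \<open>Only horizontal parts enter a bracket, which gives the factor \<open>s\<^sup>2\<close>;
  brackets are vertical, so the vertical weight has to be \<open>s\<^sup>2\<close> as well.\<close>

lemma dil_br: "dil s (br x y) = br (dil s x) (dil s y)"
proof -
  have v: "br (vpart a) b = 0" "br b (vpart a) = 0" for a b by (rule central; simp)+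
  have "br (dil s x) (dil s y) = s\<^sup>2 *\<^sub>R br x y"
    by (simp add: dil_def bilinear_ladd[OF br] bilinear_radd[OF br] bilinear_lmul[OF br] bilinear_rmul[OF br]
        v power2_eq_square)
  moreover have "dil s (br x y) = s\<^sup>2 *\<^sub>R br x y"
    by (rule zeta_eqI) (simp_all add: zeta_simps br_vertical scaleR_conv_of_real[where 'a=complex])
  ultimately show ?thesis by simp
qed

definition "herm_metric k x y = Re (herm k (\<zeta> x) (\<zeta> y))"

lemma hermitian_metric_metric: "pos_def_herm k \<Longrightarrow> hermitian_metric J (herm_metric k)"
  unfolding herm_metric_def by (rule hermitian_metric_herm[OF _ coframe])

text \<open>Horizontal entries gain \<open>s\<^sup>2\<close> from the dilation and
  \<open>\<mu>\<close> from the matrix, the vertical entry gains the square of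
  \<open>s\<^sup>2\<close>. Taking \<open>\<mu> = s\<^sup>2\<close> makes both factors
  \<open>s ^ 4\<close>.\<close>

lemma metric_dil:
  assumes k: "block_herm k" "block_herm k0" and \<mu>: "\<mu> = s\<^sup>2" and k3: "k $ 3 $ 3 = k0 $ 3 $ 3"
    and k12: "k $ 1 $ 1 = of_real \<mu> * k0 $ 1 $ 1" "k $ 2 $ 2 = of_real \<mu> * k0 $ 2 $ 2"
    "k $ 1 $ 2 = of_real \<mu> * k0 $ 1 $ 2" "k $ 2 $ 1 = of_real \<mu> * k0 $ 2 $ 1"
  shows "herm_metric k (dil s x) (dil s y) = s ^ 4 * herm_metric k0 x y"
proof -
  have "herm k (\<zeta> (dil s x)) (\<zeta> (dil s y)) = of_real (s ^ 4) * herm k0 (\<zeta> x) (\<zeta> y)"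
    using k by (simp add: herm_3 block_herm_def k3 k12 \<mu> power2_eq_square eval_nat_numeral algebra_simps)
  then show ?thesis by (simp add: herm_metric_def)
qed

lemma gauduchon_dil:
  assumes k: "pos_def_herm k" "block_herm k" and k0: "pos_def_herm k0" "block_herm k0"
    and s: "s \<noteq> 0" and \<mu>: "\<mu> = s\<^sup>2" and k3: "k $ 3 $ 3 = k0 $ 3 $ 3"
    and k12: "k $ 1 $ 1 = of_real \<mu> * k0 $ 1 $ 1" "k $ 2 $ 2 = of_real \<mu> * k0 $ 2 $ 2"
    "k $ 1 $ 2 = of_real \<mu> * k0 $ 1 $ 2" "k $ 2 $ 1 = of_real \<mu> * k0 $ 2 $ 1"
    and D: "gauduchon_connection br J (herm_metric k) \<tau> D"
  shows "gauduchon_connection br J (herm_metric k0) \<tau> (\<lambda>x y. dil (1 / s) (D (dil s x) (dil s y)))"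
proof (rule gauduchon_transport[OF linear_dil linear_dil _ _ dil_J dil_br _ D])
  show "herm_metric k0 x y = (1 / s ^ 4) * herm_metric k (dil s x) (dil s y)" for x y
    using metric_dil[OF k(2) k0(2) \<mu> k3 k12] s by simp
qed (use s in \<open>simp_all add: dil_dil\<close>)

lemma gauduchon_bilinear:
  assumes "pos_def_herm k" "gauduchon_connection br J (herm_metric k) \<tau> D"
  shows "hermitian_connection J (herm_metric k) D" "bilinear D"
proof -
  show "hermitian_connection J (herm_metric k) D"
    using gauduchon_hermitian[OF _ linear_J assms(2)] hermitian_metricD(1)[OF hermitian_metric_metric[OF assms(1)]] by simp
  then show "bilinear D" by (simp add: hermitian_connection_def)
qed

text \<open>The dilation with \<open>s = -1\<close> is an isometric automorphism exactly because the
  metric is in block form; uniqueness then makes the connection equivariant.\<close>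

lemma gauduchon_parity:
  assumes k: "pos_def_herm k" "block_herm k" and D: "gauduchon_connection br J (herm_metric k) \<tau> D"
  shows "D (dil (-1) x) (dil (-1) y) = dil (-1) (D x y)"
proof -
  have "gauduchon_connection br J (herm_metric k) \<tau> (\<lambda>x y. dil (1 / - 1) (D (dil (-1) x) (dil (-1) y)))"
    by (rule gauduchon_dil[OF k k, where \<mu> = 1]) (simp_all add: D)
  from gauduchon_unique[OF hermitian_metric_metric[OF k(1)] linear_J J_J this D]
  have "dil (1 / - 1) (D (dil (-1) x) (dil (-1) y)) = D x y" by (rule fun_cong[OF fun_cong])
  then have "dil (-1) (dil (-1) (D (dil (-1) x) (dil (-1) y))) = dil (-1) (D x y)" by simp
  then show ?thesis by (simp add: dil_dil)
qed

lemma gauduchon_trace4_vertical: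
  assumes k: "pos_def_herm k" "block_herm k" and D: "gauduchon_connection br J (herm_metric k) \<tau> D"
    and z: "z \<in> vertical"
  shows "trace4 br D z v w u = 0"
\<comment> \<open>\<open>dual e3\<close> and \<open>J (dual e3)\<close> form a real basis of the
  vertical plane.\<close>
proof (rule trace4_vertical[where U = vertical and \<sigma> = "dil (-1)" and p = "dual e3" and q = "J (dual e3)"])
  show "bilinear D" by (rule gauduchon_bilinear[OF k(1) D])
  show "D (dil (-1) x) (dil (-1) y) = dil (-1) (D x y)" for x y by (rule gauduchon_parity[OF k D])
  show "br x y \<in> vertical" for x y by (simp add: vertical_def br_vertical)
  show "br z x = 0" if "z \<in> vertical" for z x using that by (simp add: vertical_def central)
  show "\<exists>a b. z = a *\<^sub>R dual e3 + b *\<^sub>R J (dual e3)" if "z \<in> vertical" for z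
    using that
    by (intro exI[of _ "Re (\<zeta> z $ 3)"] exI[of _ "Im (\<zeta> z $ 3)"] zeta_eqI)
      (simp_all add: vertical_def zeta_simps complex_eq_iff)
  show "dil (-1) z = z" if "z \<in> vertical" for z
    using that by (intro zeta_eqI) (simp_all add: vertical_def)
  show "\<exists>h z. x = h + z \<and> dil (-1) h = - h \<and> z \<in> vertical" for x
    by (intro exI[of _ "x - vpart x"] exI[of _ "vpart x"] conjI; (rule zeta_eqI)?) (simp_all add: zeta_simps vertical_def)
qed (simp_all add: linear_dil dil_dil z)

text \<open>Conjugation by the dilation disappears under the trace, and each of the four horizontal
  arguments contributes one factor \<open>s\<close>.\<close>

lemma trace4_dil:
  assumes D: "bilinear D" and s: "s \<noteq> 0" and v: "\<zeta> v1 $ 3 = 0" "\<zeta> v2 $ 3 = 0" "\<zeta> v3 $ 3 = 0" "\<zeta> v4 $ 3 = 0"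
  shows "trace4 br (\<lambda>x y. dil (1 / s) (D (dil s x) (dil s y))) v1 v2 v3 v4 = s ^ 4 * trace4 br D v1 v2 v3 v4"
proof -
  have h: "dil s x = s *\<^sub>R x" if "\<zeta> x $ 3 = 0" for x
    using that by (intro zeta_eqI) (simp_all add: zeta_simps scaleR_conv_of_real[where 'a=complex])
  have c: "curv br (\<lambda>x y. dil (1 / s) (D (dil s x) (dil s y))) a b r = dil (1 / s) (curv br D (dil s a) (dil s b) (dil s r))" for a b r
    using s by (simp add: curv_def dil_br[symmetric] linear_diff[OF linear_dil] dil_dil)
  have sc: "curv br D (s *\<^sub>R a) (s *\<^sub>R b) r = s\<^sup>2 *\<^sub>R curv br D a b r" for a b r
    by (simp add: curv_def bilinear_lmul[OF D] bilinear_rmul[OF D] bilinear_lmul[OF br] bilinear_rmul[OF br]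
        power2_eq_square scaleR_diff_right)
  have "trace_op (\<lambda>r. dil (1 / s) (curv br D (s *\<^sub>R a) (s *\<^sub>R b) (dil s (dil (1 / s) (curv br D (s *\<^sub>R c) (s *\<^sub>R d) (dil s r))))))
     = s ^ 4 * trace_op (\<lambda>r. curv br D a b (curv br D c d r))" for a b c d
  proof -
    note l = linear_curv[OF D]
    have "trace_op (\<lambda>r. dil (1 / s) (curv br D (s *\<^sub>R a) (s *\<^sub>R b) (curv br D (s *\<^sub>R c) (s *\<^sub>R d) (dil s r))))
      = trace_op (\<lambda>r. curv br D (s *\<^sub>R a) (s *\<^sub>R b) (curv br D (s *\<^sub>R c) (s *\<^sub>R d) r))"
      by (rule trace_op_conj[OF linear_dil linear_dil linear_compose[OF l l, unfolded o_def]])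
        (use s in \<open>simp add: dil_dil\<close>)
    then show ?thesis
      using s by (simp add: dil_dil sc linear_scale[OF l] trace_op_scaleR flip: power_add)
  qed
  then show ?thesis by (simp add: trace4_def c h v algebra_simps)
qed

end

section \<open>The flows\<close>

lemma ext_d_cong: "(\<And>x y us. \<alpha> (br x y # us) = \<beta> (br x y # us)) \<Longrightarrow> ext_d br \<alpha> = ext_d br \<beta>"
  by (rule ext) (simp add: ext_d_def)

lemma eta_1212_shear: "eta_1212 (\<lambda>v. shear s (\<eta> v)) = eta_1212 \<eta>"
  by (simp add: eta_1212_def cof_def cofbar_def)

text \<open>The coframe enters the flow only through the metric form, \<open>norm_Psi\<close> and
  \<open>eta_1212\<close>, all of which a shear preserves.\<close>

lemma flow_F1_shear:
  assumes "s $ 3 = 0"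
  shows "flow_F1 br J (\<lambda>v. shear s (\<eta> v)) \<alpha>' \<tau> dbar \<Phi> \<kappa> u I (\<lambda>t. shear_herm s (h t)) H
    \<longleftrightarrow> flow_F1 br J \<eta> \<alpha>' \<tau> dbar \<Phi> \<kappa> u I h H"
  using assms by (simp add: flow_F1_def metric_flow_def metric_form_shear norm_Psi_shear eta_1212_shear)

lemma flow_F2_shear:
  assumes "s $ 3 = 0"
  shows "flow_F2 br J (\<lambda>v. shear s (\<eta> v)) \<alpha>' \<tau> I (\<lambda>t. shear_herm s (h t)) \<longleftrightarrow> flow_F2 br J \<eta> \<alpha>' \<tau> I h"
  using assms by (simp add: flow_F2_def metric_flow_def metric_form_shear norm_Psi_shear)

definition conformal_block ::
  "('g \<Rightarrow> complex ^ 3) \<Rightarrow> real \<Rightarrow> complex \<Rightarrow> real \<Rightarrow> real set \<Rightarrow> (real \<Rightarrow> complex ^ 3 ^ 3) \<Rightarrow> (real \<Rightarrow> real) \<Rightarrow> bool" where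
  "conformal_block \<zeta> a b c I k r \<longleftrightarrow>
     (\<forall>t\<in>I. \<forall>vs. metric_form \<zeta> (k t) vs =
        \<i> / 2 * of_real ((r t)\<^sup>2) *
          (eta_bar \<zeta> 1 1 vs + of_real a * eta_bar \<zeta> 2 2 vs +
           b * eta_bar \<zeta> 1 2 vs + cnj b * eta_bar \<zeta> 2 1 vs) +
        \<i> / 2 * of_real c * eta_bar \<zeta> 3 3 vs)"

context central_coframe
begin

lemma central_coframe_shear: "central_coframe br J (\<lambda>v. shear s (\<zeta> v))"
  using coframe10_shear[OF coframe] br linear_J J_J br_vertical central
  by (simp add: central_coframe_def)

lemma metric_of_eq: "pos_def_herm h \<Longrightarrow> metric_of J (metric_form \<zeta> h) = herm_metric h"
  by (intro ext) (simp only: metric_of_metric_form[OF pos_def_herm_cnj coframe] herm_metric_def)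

lemma trace_curv_trace4:
  assumes h: "pos_def_herm h" and D: "gauduchon_connection br J (herm_metric h) \<tau> D"
    and e: "orthonormal_frame (herm_metric h) e"
  shows "trace_curv br (herm_metric h) D e [v1, v2, v3, v4] = complex_of_real (- trace4 br D v1 v2 v3 v4)"
proof (rule trace_curv_eq[OF _ e])
  show "pd_inner (herm_metric h)" using hermitian_metric_metric[OF h] by (simp add: hermitian_metric_def)
  show "metric_connection (herm_metric h) D"
    using gauduchon_bilinear[OF h D] by (simp add: metric_connection_def hermitian_connection_def)
qed

text \<open>Block form at later times is deduced from this vanishing, so it cannot be presupposed
  here. Each metric is brought to block form by its own shear, which leaves the vertical plane
  unchanged.\<close>

lemma trace4_vertical_pos_def:
  assumes h: "pos_def_herm h" and D: "gauduchon_connection br J (herm_metric h) \<tau> D" and z: "z \<in> vertical"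
  shows "trace4 br D z v w u = 0"
proof -
  define s where "s = block_shear h"
  interpret S: central_coframe br J "\<lambda>v. shear s (\<zeta> v)" by (rule central_coframe_shear)
  have "s $ 3 = 0" by (simp add: s_def)
  then have "S.herm_metric (shear_herm s h) = herm_metric h"
    by (intro ext) (simp add: S.herm_metric_def herm_metric_def herm_shear)
  moreover have "pos_def_herm (shear_herm s h)" "block_herm (shear_herm s h)"
    unfolding s_def by (rule pos_def_shear_herm[OF h block_shear_3] block_herm_shear[OF h])+
  moreover have "z \<in> S.vertical" using z by (simp add: vertical_def S.vertical_def)
  ultimately show ?thesis using S.gauduchon_trace4_vertical D by metis
qed

lemma i_del_delbar_metric_form_vertical:
  assumes z: "z \<in> vertical"
  shows "i_del_delbar br J (metric_form \<zeta> h) [z, a, b, c] = 0"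
proof (rule i_del_delbar_vertical[OF _ _ _ _ _ _ _ z])
  show "J 0 = 0" by (rule linear_0[OF linear_J])
qed (simp_all add: vertical_def br_vertical central zeta_J metric_form_eq form2_def herm_def linear_0[OF linear_zeta])

lemma eta_1212_vertical: "z \<in> vertical \<Longrightarrow> eta_1212 \<zeta> [z, a, b, c] = 0"
  by (simp add: eta_1212_def cof_def cofbar_def form1_def vertical_def)

lemma flow_F2_rhs:
  assumes F: "flow_F2 br J \<zeta> \<alpha>' \<tau> I k" and t: "t \<in> I" and k: "pos_def_herm (k t)"
  obtains D R where "gauduchon_connection br J (herm_metric (k t)) \<tau> D" "metric_flow \<zeta> I k t R"
    "\<And>v1 v2 v3 v4. R [v1, v2, v3, v4] = i_del_delbar br J (metric_form \<zeta> (k t)) [v1, v2, v3, v4]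
        + complex_of_real (\<alpha>' / 4 * trace4 br D v1 v2 v3 v4)"
proof -
  from F t obtain D e where De: "gauduchon_connection br J (herm_metric (k t)) \<tau> D" "orthonormal_frame (herm_metric (k t)) e"
    "metric_flow \<zeta> I k t (\<lambda>vs. i_del_delbar br J (metric_form \<zeta> (k t)) vs -
        complex_of_real (\<alpha>' / 4) * trace_curv br (herm_metric (k t)) D e vs)"
    unfolding flow_F2_def Let_def metric_of_eq[OF k, symmetric] by blast
  show thesis
    by (rule that[OF De(1) De(3)]) (simp add: trace_curv_trace4[OF k De(1) De(2)])
qed

lemma flow_F2_vertical:
  assumes F: "flow_F2 br J \<zeta> \<alpha>' \<tau> I k" and t: "t \<in> I" and k: "pos_def_herm (k t)"
  shows "\<exists>R. metric_flow \<zeta> I k t R \<and> (\<forall>z\<in>vertical. \<forall>a b c. R [z, a, b, c] = 0)"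
proof -
  obtain D R where "gauduchon_connection br J (herm_metric (k t)) \<tau> D" "metric_flow \<zeta> I k t R"
    "\<And>v1 v2 v3 v4. R [v1, v2, v3, v4] = i_del_delbar br J (metric_form \<zeta> (k t)) [v1, v2, v3, v4]
        + complex_of_real (\<alpha>' / 4 * trace4 br D v1 v2 v3 v4)"
    using flow_F2_rhs[where \<tau> = \<tau>, OF F t k] by blast
  then show ?thesis
    by (intro exI[of _ R]) (simp add: i_del_delbar_metric_form_vertical trace4_vertical_pos_def[OF k])
qed

lemma flow_F1_vertical:
  fixes H :: "real \<Rightarrow> complex ^ 'n ^ 'n"
  assumes F: "flow_F1 br J \<zeta> \<alpha>' \<tau> dbar \<Phi> \<kappa> u I k H" and t: "t \<in> I" and k: "pos_def_herm (k t)"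
  shows "\<exists>R. metric_flow \<zeta> I k t R \<and> (\<forall>z\<in>vertical. \<forall>a b c. R [z, a, b, c] = 0)"
proof -
  from F t obtain D e A f m where *: "gauduchon_connection br J (herm_metric (k t)) \<tau> D" "orthonormal_frame (herm_metric (k t)) e"
    "\<forall>vs. trace_curv br (\<lambda>z w. Re (herm (H t) z w)) A f vs = m * eta_1212 \<zeta> vs"
    "metric_flow \<zeta> I k t (\<lambda>vs. i_del_delbar br J (metric_form \<zeta> (k t)) vs -
        complex_of_real (\<alpha>' / 4) * (trace_curv br (herm_metric (k t)) D e vs - trace_curv br (\<lambda>z w. Re (herm (H t) z w)) A f vs))"
    unfolding flow_F1_def Let_def metric_of_eq[OF k, symmetric] by blast
  show ?thesis
    by (rule exI, rule conjI[OF *(4)])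
      (simp add: i_del_delbar_metric_form_vertical eta_1212_vertical *(3) trace_curv_trace4[OF k *(1,2)]
        trace4_vertical_pos_def[OF k *(1)])
qed

section \<open>From the flow equation to the conformal factor\<close>

lemma metric_flow_vertical_const:
  assumes I: "is_interval I" "0 \<in> I" and pos: "\<And>t. t \<in> I \<Longrightarrow> pos_def_herm (k t)"
    and R: "\<And>t. t \<in> I \<Longrightarrow> \<exists>R. metric_flow \<zeta> I k t R \<and> (\<forall>z\<in>vertical. \<forall>a b c. R [z, a, b, c] = 0)"
    and t: "t \<in> I"
  shows "omega_sq (k t) e3 a b c = omega_sq (k 0) e3 a b c"
proof -
  define F where "F s = complex_of_real (norm_Psi (k s)) *
    wedge (metric_form \<zeta> (k s)) (metric_form \<zeta> (k s)) [dual e3, dual a, dual b, dual c]" for s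
  have F: "F s = complex_of_real (omega_sq (k s) e3 a b c)" if "s \<in> I" for s
    unfolding F_def omega_sq_metric_form[OF pos_def_herm_cnj[OF pos[OF that]]] by simp
  have "(F has_vector_derivative 0) (at s within I)" if s: "s \<in> I" for s
  proof -
    obtain R where R': "metric_flow \<zeta> I k s R" "R [dual e3, dual a, dual b, dual c] = 0"
      using R[OF s] by (auto simp: vertical_def)
    have "(F has_vector_derivative R [dual e3, dual a, dual b, dual c]) (at s within I)"
      unfolding F_def using R'(1) unfolding metric_flow_def by blast
    then show ?thesis by (simp only: R'(2))
  qed
  then have "F t = F 0"
    using I t has_vector_derivative_zero_constant[of I F] is_interval_convex_1 by metis
  then show ?thesis using F I t by simp
qed

text \<open>The constants are fixed by \<open>k0\<close> before any flow is given, and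
  \<open>K2\<close> is a function of \<open>\<alpha>'\<close> and \<open>\<tau>\<close>; this order
  of choice records what each of them depends on.\<close>

lemma flow_block:
  assumes k0: "pos_def_herm k0" "block_herm k0"
  obtains a c K1 :: real and b :: complex and K2 :: "real \<Rightarrow> real \<Rightarrow> real" where
    "\<And>\<alpha>' \<tau> I k. is_interval I \<Longrightarrow> 0 \<in> I \<Longrightarrow> (\<And>t. t \<in> I \<Longrightarrow> pos_def_herm (k t)) \<Longrightarrow> k 0 = k0 \<Longrightarrow>
       (\<exists>(dbar :: 'g \<Rightarrow> complex ^ 'n \<Rightarrow> complex ^ 'n) \<Phi> \<kappa> u H. flow_F1 br J \<zeta> \<alpha>' \<tau> dbar \<Phi> \<kappa> u I k H) \<or>
       flow_F2 br J \<zeta> \<alpha>' \<tau> I k \<Longrightarrow>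
       \<exists>r. conformal_block \<zeta> a b c I k r \<and>
         (flow_F2 br J \<zeta> \<alpha>' \<tau> I k \<longrightarrow>
           (\<forall>t\<in>I. ((\<lambda>s. (r s)\<^sup>2) has_real_derivative K1 + K2 \<alpha>' \<tau> / (r t) ^ 4) (at t within I)))"
proof -
  obtain A0 B0 C b0 where e0: "k0 $ 1 $ 1 = complex_of_real A0" "k0 $ 2 $ 2 = complex_of_real B0" "k0 $ 3 $ 3 = complex_of_real C"
    "k0 $ 1 $ 2 = b0" "k0 $ 2 $ 1 = cnj b0" "0 < A0" "0 < C" "(cmod b0)\<^sup>2 < A0 * B0"
    using pos_def_entries[OF k0(1)] by metis
  \<comment> \<open>The entry \<open>A0\<close> is absorbed into the conformal factor, so
    \<open>(r 0)\<^sup>2 = A0\<close>.\<close>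
  define a b where "a = B0 / A0" and "b = b0 / A0"
  have ab: "(cmod b)\<^sup>2 < a"
    using e0(6,8) by (simp add: a_def b_def norm_divide power2_eq_square field_simps)
  \<comment> \<open>A real frame of the horizontal space: its component is the one left undetermined
    by the vertical conservation laws.\<close>
  define v1 v2 v3 v4 where "v1 = dual e1" and "v2 = dual (\<i> *s e1)" and "v3 = dual e2" and "v4 = dual (\<i> *s e2)"
  have v: "\<zeta> v1 = e1" "\<zeta> v2 = \<i> *s e1" "\<zeta> v3 = e2" "\<zeta> v4 = \<i> *s e2"
    by (simp_all add: v1_def v2_def v3_def v4_def)
  \<comment> \<open>By \<open>omega_sq_horizontal\<close>, that component of the evolving four-form
    is \<open>q * (r t)\<^sup>2\<close>.\<close>
  define q where "q = 2 * sqrt (8 * (a - (cmod b)\<^sup>2) / C)"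
  have q: "0 < q" using ab e0(7) by (simp add: q_def)
  define K1 where "K1 = Re (i_del_delbar br J (metric_form \<zeta> k0) [v1, v2, v3, v4]) / q"
  \<comment> \<open>If the initial metric had no Gauduchon connection, \<open>SOME\<close> would be junk, but then there would be no
    flow either; uniqueness identifies the choice with the rescaled connection at time \<open>t\<close>.\<close>
  define K2 where "K2 \<alpha>' \<tau> = \<alpha>' / 4 * A0\<^sup>2 * trace4 br (SOME D. gauduchon_connection br J (herm_metric k0) \<tau> D) v1 v2 v3 v4 / q"
    for \<alpha>' \<tau>
  show thesis
  proof (rule that[of a b C K1 K2])
    fix \<alpha>' \<tau> I k
    assume I: "is_interval I" "0 \<in> I" and pos: "\<And>t. t \<in> I \<Longrightarrow> pos_def_herm (k t)" and k_0: "k 0 = k0"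
      and F: "(\<exists>(dbar :: 'g \<Rightarrow> complex ^ 'n \<Rightarrow> complex ^ 'n) \<Phi> \<kappa> u H. flow_F1 br J \<zeta> \<alpha>' \<tau> dbar \<Phi> \<kappa> u I k H) \<or>
              flow_F2 br J \<zeta> \<alpha>' \<tau> I k"
    have R: "\<exists>R. metric_flow \<zeta> I k t R \<and> (\<forall>z\<in>vertical. \<forall>a b c. R [z, a, b, c] = 0)" if t: "t \<in> I" for t
      using F
    proof
      assume "\<exists>(dbar :: 'g \<Rightarrow> complex ^ 'n \<Rightarrow> complex ^ 'n) \<Phi> \<kappa> u H. flow_F1 br J \<zeta> \<alpha>' \<tau> dbar \<Phi> \<kappa> u I k H"
      then show ?thesis using flow_F1_vertical t pos by blast
    next
      assume "flow_F2 br J \<zeta> \<alpha>' \<tau> I k"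
      then show ?thesis using flow_F2_vertical t pos by blast
    qed
    have const: "omega_sq (k t) e3 a b c = omega_sq k0 e3 a b c" if "t \<in> I" for t a b c
      using metric_flow_vertical_const[OF I pos R that, of a b c] k_0 by simp
    have block: "block_herm (k t)" if "t \<in> I" for t
      by (rule omega_sq_vertical_imp_block[OF k0 pos[OF that] const[OF that]])
    define \<mu> where "\<mu> t = Re (k t $ 1 $ 1) / Re (k0 $ 1 $ 1)" for t
    note \<mu> = omega_sq_vertical_eq[OF k0 pos block const \<mu>_def]
    define r where "r t = sqrt (\<mu> t * A0)" for t
    have r: "(r t)\<^sup>2 = \<mu> t * A0" if "t \<in> I" for t
      using \<mu>(1)[OF that that that] e0(6) by (simp add: r_def)
    have ent: "k t $ 1 $ 1 = of_real ((r t)\<^sup>2)" "k t $ 2 $ 2 = of_real ((r t)\<^sup>2 * a)" "k t $ 3 $ 3 = of_real C"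
      "k t $ 1 $ 2 = of_real ((r t)\<^sup>2) * b" "k t $ 2 $ 1 = of_real ((r t)\<^sup>2) * cnj b" if "t \<in> I" for t
      using \<mu>(2-6)[OF that that that] e0 by (simp_all add: r[OF that] a_def b_def)
    have form: "metric_form \<zeta> (k t) vs =
                    \<i> / 2 * of_real ((r t)\<^sup>2) *
                      (eta_bar \<zeta> 1 1 vs + of_real a * eta_bar \<zeta> 2 2 vs +
                       b * eta_bar \<zeta> 1 2 vs + cnj b * eta_bar \<zeta> 2 1 vs) +
                    \<i> / 2 * of_real C * eta_bar \<zeta> 3 3 vs" if "t \<in> I" for t vs
      using block[OF that]
      by (simp add: metric_form_def sum_3 ent[OF that] block_herm_def algebra_simps)
    moreover have "((\<lambda>s. (r s)\<^sup>2) has_real_derivative K1 + K2 \<alpha>' \<tau> / (r t) ^ 4) (at t within I)"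
      if F2: "flow_F2 br J \<zeta> \<alpha>' \<tau> I k" and t: "t \<in> I" for t
    proof -
      note \<mu>t = \<mu>[OF t t t]
      obtain D R where D: "gauduchon_connection br J (herm_metric (k t)) \<tau> D" and fl: "metric_flow \<zeta> I k t R"
        and Rv: "R [v1, v2, v3, v4] = i_del_delbar br J (metric_form \<zeta> (k t)) [v1, v2, v3, v4]
        + complex_of_real (\<alpha>' / 4 * trace4 br D v1 v2 v3 v4)"
        using flow_F2_rhs[where \<tau> = \<tau>, OF F2 t pos[OF t]] by metis
      \<comment> \<open>\<open>ext_d\<close> feeds a commutator into the form. It is vertical, so in
        block form it meets only the entry \<open>k t $ 3 $ 3\<close>, which is constant in
        time.\<close>
      have idd: "i_del_delbar br J (metric_form \<zeta> (k t)) = i_del_delbar br J (metric_form \<zeta> k0)"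
      proof -
        have "ext_d br (metric_form \<zeta> (k t)) = ext_d br (metric_form \<zeta> k0)"
          using block[OF t] k0(2) \<mu>t(2)
          by (intro ext_d_cong) (auto simp: metric_form_eq form2_def herm_3 br_vertical block_herm_def split: list.split)
        then show ?thesis by (simp add: i_del_delbar_def dol_delbar_def)
      qed
      \<comment> \<open>The dilation factor is \<open>s ^ 4 = (\<mu> t)\<^sup>2\<close>, and
        \<open>(r t)\<^sup>2 = \<mu> t * A0\<close> turns it into
        \<open>(r t) ^ 4 / A0\<^sup>2\<close>.\<close>
      have tr: "(r t) ^ 4 * trace4 br D v1 v2 v3 v4 =
        A0\<^sup>2 * trace4 br (SOME D. gauduchon_connection br J (herm_metric k0) \<tau> D) v1 v2 v3 v4"
      proof -
        define s where "s = sqrt (\<mu> t)"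
        have s: "s \<noteq> 0" "\<mu> t = s\<^sup>2" using \<mu>t(1) by (simp_all add: s_def)
        have D': "gauduchon_connection br J (herm_metric k0) \<tau> (\<lambda>x y. dil (1 / s) (D (dil s x) (dil s y)))"
          by (rule gauduchon_dil[OF pos[OF t] block[OF t] k0 s \<mu>t(2-6) D])
        then have "gauduchon_connection br J (herm_metric k0) \<tau> (SOME D. gauduchon_connection br J (herm_metric k0) \<tau> D)"
          by (rule someI[of "gauduchon_connection br J (herm_metric k0) \<tau>"])
        then have "(SOME D. gauduchon_connection br J (herm_metric k0) \<tau> D) = (\<lambda>x y. dil (1 / s) (D (dil s x) (dil s y)))"
          using gauduchon_unique[OF hermitian_metric_metric[OF k0(1)] linear_J J_J _ D'] by blast
        moreover have "trace4 br (\<lambda>x y. dil (1 / s) (D (dil s x) (dil s y))) v1 v2 v3 v4 = s ^ 4 * trace4 br D v1 v2 v3 v4"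
          by (rule trace4_dil[OF gauduchon_bilinear(2)[OF pos[OF t] D] s(1)]) (simp_all add: v)
        moreover have "(r t) ^ 4 = A0\<^sup>2 * s ^ 4"
        proof -
          have "(r t) ^ 4 = ((r t)\<^sup>2)\<^sup>2" by simp
          also have "\<dots> = A0\<^sup>2 * s ^ 4"
            unfolding r[OF t] s(2) by (simp add: power_mult_distrib)
          finally show ?thesis .
        qed
        ultimately show ?thesis by simp
      qed
      have r0: "r t \<noteq> 0" using \<mu>t(1) e0(6) by (simp add: r_def)
      have "((\<lambda>s. complex_of_real (norm_Psi (k s)) *
          wedge (metric_form \<zeta> (k s)) (metric_form \<zeta> (k s)) [v1, v2, v3, v4])
            has_vector_derivative R [v1, v2, v3, v4]) (at t within I)"
        using fl unfolding metric_flow_def by blast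
      moreover have "complex_of_real (norm_Psi (k s)) *
          wedge (metric_form \<zeta> (k s)) (metric_form \<zeta> (k s)) [v1, v2, v3, v4] = of_real (q * (r s)\<^sup>2)" if s: "s \<in> I" for s
      proof -
        have "omega_sq (k s) e1 (\<i> *s e1) e2 (\<i> *s e2) = q * (r s)\<^sup>2"
          unfolding q_def
          by (rule omega_sq_horizontal[OF block[OF s] ent[OF s] _ e0(7) ab]) (use \<mu>(1)[OF s s s] e0(6) in \<open>simp add: r[OF s]\<close>)
        then show ?thesis
          unfolding omega_sq_metric_form[OF pos_def_herm_cnj[OF pos[OF s]]] v by simp
      qed
      ultimately have "((\<lambda>s. complex_of_real (q * (r s)\<^sup>2)) has_vector_derivative R [v1, v2, v3, v4]) (at t within I)"
        using t by (metis (no_types, lifting) has_vector_derivative_transform)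
      then have "((\<lambda>s. Re (complex_of_real (q * (r s)\<^sup>2))) has_vector_derivative Re (R [v1, v2, v3, v4])) (at t within I)"
        by (rule bounded_linear.has_vector_derivative[OF bounded_linear_Re])
      then have "((\<lambda>s. q * (r s)\<^sup>2) has_real_derivative Re (R [v1, v2, v3, v4])) (at t within I)"
        by (simp add: has_real_derivative_iff_has_vector_derivative)
      then have "((\<lambda>s. q * (r s)\<^sup>2 / q) has_real_derivative Re (R [v1, v2, v3, v4]) / q) (at t within I)"
        by (rule DERIV_cdivide)
      moreover have "Re (R [v1, v2, v3, v4]) / q = K1 + K2 \<alpha>' \<tau> / (r t) ^ 4"
      proof -
        have "K2 \<alpha>' \<tau> = \<alpha>' / 4 * ((r t) ^ 4 * trace4 br D v1 v2 v3 v4) / q"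
          unfolding tr by (simp add: K2_def)
        then show ?thesis using r0 by (simp add: Rv idd K1_def add_divide_distrib)
      qed
      ultimately show ?thesis using q by simp
    qed
    ultimately show "\<exists>r. conformal_block \<zeta> a b C I k r \<and>
         (flow_F2 br J \<zeta> \<alpha>' \<tau> I k \<longrightarrow>
           (\<forall>t\<in>I. ((\<lambda>s. (r s)\<^sup>2) has_real_derivative K1 + K2 \<alpha>' \<tau> / (r t) ^ 4) (at t within I)))"
      unfolding conformal_block_def by blast
  qed
qed

end

theorem theorem1:
  fixes br :: "'g::euclidean_space \<Rightarrow> 'g \<Rightarrow> 'g"
    and J :: "'g \<Rightarrow> 'g"
    and \<Gamma> :: "'g set"
    and \<eta> :: "'g \<Rightarrow> complex ^ 3"
    and \<rho> \<mu> x y :: real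
    and h0 :: "complex ^ 3 ^ 3"
  assumes dim: "DIM('g) = 6"
    and nilp: "two_step_nilpotent br"
    and lattice: "cocompact_lattice br \<Gamma>"
    and b1: "betti 1 (nilmanifold br \<Gamma>) \<ge> 4"
    and J: "complex_structure br J"
    and nonpar: "\<not> parallelizable br J"
    and eta: "coframe10 J \<eta>"
    and rho: "\<rho> \<in> {0, 1}"
    and lam: "\<mu> \<ge> 0"
    and d1: "\<forall>vs. ext_d br (cof \<eta> 1) vs = 0"
    and d2: "\<forall>vs. ext_d br (cof \<eta> 2) vs = 0"
    and d3: "\<forall>vs. ext_d br (cof \<eta> 3) vs =
               of_real \<rho> * wedge (cof \<eta> 1) (cof \<eta> 2) vs + eta_bar \<eta> 1 1 vs +
               of_real \<mu> * eta_bar \<eta> 1 2 vs + Complex x y * eta_bar \<eta> 2 2 vs"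
    and h0: "pos_def_herm h0"
  shows "\<exists>(\<zeta> :: 'g \<Rightarrow> complex ^ 3) (a :: real) (b :: complex) (c :: real) (K1 :: real).
           coframe10 J \<zeta> \<and>
           (\<forall>\<alpha>' \<tau>. \<exists>K2 :: real. \<forall>I h.
              is_interval I \<longrightarrow> 0 \<in> I \<longrightarrow> (\<forall>t\<in>I. pos_def_herm (h t)) \<longrightarrow> h 0 = h0 \<longrightarrow>
              (\<exists>(dbar :: 'g \<Rightarrow> complex ^ 'n \<Rightarrow> complex ^ 'n) \<Phi> \<kappa> u H.
                  holomorphic_bundle br J dbar \<and> u \<in> {1, \<i>, - \<i>} \<and>
                  flow_F1 br J \<eta> \<alpha>' \<tau> dbar \<Phi> \<kappa> u I h H) \<or>
              flow_F2 br J \<eta> \<alpha>' \<tau> I h \<longrightarrow>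
              (\<exists>r :: real \<Rightarrow> real.
                 (\<forall>t\<in>I. \<forall>vs. metric_form \<eta> (h t) vs =
                    \<i> / 2 * of_real ((r t)\<^sup>2) *
                      (eta_bar \<zeta> 1 1 vs + of_real a * eta_bar \<zeta> 2 2 vs +
                       b * eta_bar \<zeta> 1 2 vs + cnj b * eta_bar \<zeta> 2 1 vs) +
                    \<i> / 2 * of_real c * eta_bar \<zeta> 3 3 vs) \<and>
                 (flow_F2 br J \<eta> \<alpha>' \<tau> I h \<longrightarrow>
                    (\<forall>t\<in>I. ((\<lambda>s. (r s)\<^sup>2) has_real_derivative K1 + K2 / (r t) ^ 4)
                              (at t within I)))))"
  proof -
  have br: "bilinear br" using nilp by (simp add: two_step_nilpotent_def lie_bracket_def)
  have lJ: "linear J" and JJ: "J (J x) = - x" for x using J by (auto simp: complex_structure_def)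
  have lin: "linear \<eta>" and bij: "bij \<eta>" using eta by (auto simp: coframe10_def)
  have br1: "\<eta> (br v w) $ 1 = 0" and br2: "\<eta> (br v w) $ 2 = 0" for v w
    using d1[rule_format, of "[v, w]"] d2[rule_format, of "[v, w]"] by (simp_all add: cof_def ext_d_form1)
  \<comment> \<open>Every term on the right contains a first or second coordinate of both
    \<open>v\<close> and \<open>w\<close>; hence vectors whose first two coordinates vanish are
    central.\<close>
  have br3: "- \<eta> (br v w) $ 3 = of_real \<rho> * (\<eta> v $ 1 * \<eta> w $ 2 - \<eta> w $ 1 * \<eta> v $ 2) +
      (\<eta> v $ 1 * cnj (\<eta> w $ 1) - \<eta> w $ 1 * cnj (\<eta> v $ 1)) +
      of_real \<mu> * (\<eta> v $ 1 * cnj (\<eta> w $ 2) - \<eta> w $ 1 * cnj (\<eta> v $ 2)) +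
      Complex x y * (\<eta> v $ 2 * cnj (\<eta> w $ 2) - \<eta> w $ 2 * cnj (\<eta> v $ 2))" for v w
    using d3[rule_format, of "[v, w]"]
    by (simp add: cof_def cofbar_def eta_bar_def ext_d_form1 wedge_form1 del: wedge.simps)
  have eta0: "v = 0" if "\<eta> v $ 1 = 0" "\<eta> v $ 2 = 0" "\<eta> v $ 3 = 0" for v
  proof -
    have "\<eta> v = \<eta> 0" using that by (simp add: vec3_eq_iff linear_0[OF lin])
    then show ?thesis using bij by (metis bij_is_inj injD)
  qed
  interpret central_coframe br J \<eta>
  proof (rule central_coframe.intro[OF br lJ JJ eta br1 br2])
    fix z v assume z: "\<eta> z $ 1 = 0" "\<eta> z $ 2 = 0"
    show "br z v = 0" using br3[of z v] z by (intro eta0[OF br1 br2]) simp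
    show "br v z = 0" using br3[of v z] z by (intro eta0[OF br1 br2]) simp
  qed
  \<comment> \<open>The shear is adapted to the initial metric and kept for all times; the sheared
    coframe is the required \<open>\<zeta>\<close>.\<close>
  define s where "s = block_shear h0"
  have s: "s $ 3 = 0" by (simp add: s_def)
  interpret S: central_coframe br J "\<lambda>v. shear s (\<eta> v)" by (rule central_coframe_shear)
  have k0: "pos_def_herm (shear_herm s h0)" "block_herm (shear_herm s h0)"
    using pos_def_shear_herm[OF h0 s] block_herm_shear[OF h0] by (simp_all add: s_def)
  show ?thesis
  proof (rule S.flow_block[OF k0, where 'n = 'n])
    fix a c K1 :: real and b :: complex and K2 :: "real \<Rightarrow> real \<Rightarrow> real"
    assume *:
      "\<And>\<alpha>' \<tau> I k. is_interval I \<Longrightarrow> 0 \<in> I \<Longrightarrow> (\<And>t. t \<in> I \<Longrightarrow> pos_def_herm (k t)) \<Longrightarrow>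
         k 0 = shear_herm s h0 \<Longrightarrow>
         (\<exists>(dbar :: 'g \<Rightarrow> complex ^ 'n \<Rightarrow> complex ^ 'n) \<Phi> \<kappa> u H.
            flow_F1 br J (\<lambda>v. shear s (\<eta> v)) \<alpha>' \<tau> dbar \<Phi> \<kappa> u I k H) \<or>
         flow_F2 br J (\<lambda>v. shear s (\<eta> v)) \<alpha>' \<tau> I k \<Longrightarrow>
         \<exists>r. conformal_block (\<lambda>v. shear s (\<eta> v)) a b c I k r \<and>
           (flow_F2 br J (\<lambda>v. shear s (\<eta> v)) \<alpha>' \<tau> I k \<longrightarrow>
             (\<forall>t\<in>I. ((\<lambda>s. (r s)\<^sup>2) has_real_derivative K1 + K2 \<alpha>' \<tau> / (r t) ^ 4) (at t within I)))"
    show ?thesis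
    proof (rule exI[of _ "\<lambda>v. shear s (\<eta> v)"], rule exI[of _ a], rule exI[of _ b], rule exI[of _ c],
        rule exI[of _ K1], intro conjI allI, rule S.coframe, goal_cases)
      case (1 \<alpha>' \<tau>)
      show ?case
      proof (intro exI[of _ "K2 \<alpha>' \<tau>"] allI impI, goal_cases)
        case (1 I h)
        have "(\<exists>(dbar :: 'g \<Rightarrow> complex ^ 'n \<Rightarrow> complex ^ 'n) \<Phi> \<kappa> u H.
             flow_F1 br J (\<lambda>v. shear s (\<eta> v)) \<alpha>' \<tau> dbar \<Phi> \<kappa> u I (\<lambda>t. shear_herm s (h t)) H) \<or>
          flow_F2 br J (\<lambda>v. shear s (\<eta> v)) \<alpha>' \<tau> I (\<lambda>t. shear_herm s (h t))"
          unfolding flow_F1_shear[OF s] flow_F2_shear[OF s] using 1(5) by blast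
        from *[OF 1(1,2) _ _ this] show ?case
          using 1(3,4) pos_def_shear_herm[OF _ s]
          unfolding conformal_block_def metric_form_shear[OF s] flow_F2_shear[OF s] by blast
      qed
    qed
  qed
qed

end
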